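(* Let $ABC$ be an equilateral triangle that is $N$-tiled by a tile with angles $(\alpha,\beta,\gamma)$, where $\gamma = 2\pi/3$ and $\alpha$ is not a rational multiple of $\pi$. Then $N$ is not a prime number.
   Context: An $N$-tiling of a triangle $ABC$ by a tile $T$ is a decomposition of $ABC$ into $N$ triangles, each congruent to $T$, with pairwise disjoint interiors. *)

theory Defs
  imports "HOL-Analysis.Analysis" "HOL-Computational_Algebra.Primes"
begin

(* Unoriented angle at the middle point b, with values in [0, pi].
   Only meaningful for a \<noteq> b and c \<noteq> b. *)
definition angle :: "real^2 \<Rightarrow> real^2 \<Rightarrow> real^2 \<Rightarrow> real" where
  "angle a b c = arccos (((a - b) \<bullet> (c - b)) / (norm (a - b) * norm (c - b)))"

definition nondegenerate :: "real^2 \<Rightarrow> real^2 \<Rightarrow> real^2 \<Rightarrow> bool" where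
  "nondegenerate a b c \<longleftrightarrow> \<not> collinear {a, b, c}"

definition equilateral :: "real^2 \<Rightarrow> real^2 \<Rightarrow> real^2 \<Rightarrow> bool" where
  "equilateral a b c \<longleftrightarrow> nondegenerate a b c \<and> dist a b = dist b c \<and> dist b c = dist c a"

(* Triangles as point sets are closed and filled. *)
definition is_triangle :: "(real^2) set \<Rightarrow> bool" where
  "is_triangle S \<longleftrightarrow> (\<exists>a b c. nondegenerate a b c \<and> S = convex hull {a, b, c})"

(* Orientation-reversing isometries are allowed, so tiles may be turned over. *)
definition congruent_sets :: "(real^2) set \<Rightarrow> (real^2) set \<Rightarrow> bool" where
  "congruent_sets S T \<longleftrightarrow>
     (\<exists>f :: real^2 \<Rightarrow> real^2. (\<forall>x y. dist (f x) (f y) = dist x y) \<and> f ` T = S)"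

(* The tiles need not meet edge to edge. *)
definition tiled_by :: "nat \<Rightarrow> (real^2) set \<Rightarrow> (real^2) set \<Rightarrow> bool" where
  "tiled_by N S T \<longleftrightarrow>
     (\<exists>F. finite F \<and> card F = N
        \<and> (\<forall>t\<in>F. is_triangle t \<and> congruent_sets t T)
        \<and> \<Union>F = S
        \<and> pairwise (\<lambda>s t. disjnt (interior s) (interior t)) F)"

end

theory Submission
  imports Defs
begin

text \<open>For a unit vector \<open>d\<close>, the area of the part of a set below a line orthogonal to \<open>d\<close> is additive over
  a tiling, and for a triangle the jumps of its derivative are the signed lengths of the edges
  orthogonal to \<open>d\<close>. Hence for every odd function \<open>g\<close> on unit vectors the sum of length times \<open>g\<close> of the
  outer normal over the edges of all tiles equals the same sum over the edges of the big triangle.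

  The outer normals of a tile differ by rotations in the group generated by \<open>\<pi> / 3\<close> and \<open>\<alpha>\<close>. As
  \<open>\<alpha> / \<pi>\<close> is irrational, this group has two sign characters that are \<open>-1\<close> on \<open>\<pi> / 3\<close> and \<open>1\<close> or \<open>-1\<close> on
  \<open>\<alpha>\<close>. With sides \<open>a, b, c\<close> of the tile and side \<open>S\<close> of the big triangle they give integers \<open>n\<close>, \<open>m\<close>
  of absolute value at most \<open>N\<close> with \<open>n (c + a - b) = 3 S = m (c - a + b)\<close>. Comparing areas,
  \<open>S\<^sup>2 = N a b\<close>, so \<open>n m = 3 N\<close> since \<open>(c + a - b) (c - a + b) = 3 a b\<close>. If \<open>N\<close> is prime, \<open>n\<close> and \<open>m\<close>
  are \<open>N\<close> and \<open>3\<close>. Then \<open>c\<close>, \<open>a - b\<close> and \<open>S\<close> are commensurable, while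
  \<open>((a + b) / S)\<^sup>2 = (N + 1) (N + 9) / (2 N)\<^sup>2\<close> is not the square of a rational number. As \<open>S\<close> is a sum of tile
  sides, it must be a multiple of \<open>c\<close>, which is impossible.\<close>

subsection \<open>Areas of cut triangles\<close>

text \<open>With \<open>a\<close>, \<open>b\<close> the coordinates along \<open>v - u\<close> and
  \<open>w - u\<close>, the half-plane is \<open>a * p + b * q \<le> e\<close>. Passing to
  \<open>a * p / e\<close> and \<open>b * q / e\<close> gives the standard coordinates of the small
  triangle; \<open>e \<le> p\<close> and \<open>e \<le> q\<close> keep it inside the large
  one.\<close>

lemma triangle_corner_cut:
  fixes d u v w :: "real^2"
  assumes "d \<bullet> u < d \<bullet> v" "d \<bullet> u < d \<bullet> w" "d \<bullet> u \<le> s" "s \<le> d \<bullet> v" "s \<le> d \<bullet> w"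
  shows "convex hull {u, v, w} \<inter> {x. d \<bullet> x \<le> s} =
    convex hull {u, u + ((s - d \<bullet> u) / (d \<bullet> v - d \<bullet> u)) *\<^sub>R (v - u),
                    u + ((s - d \<bullet> u) / (d \<bullet> w - d \<bullet> u)) *\<^sub>R (w - u)}"
proof -
  define p q e where "p = d \<bullet> v - d \<bullet> u" and "q = d \<bullet> w - d \<bullet> u" and "e = s - d \<bullet> u"
  have pq: "p > 0" "q > 0" "0 \<le> e" "e \<le> p" "e \<le> q"
    using assms by (auto simp: p_def q_def e_def)
  have level: "d \<bullet> (u + a *\<^sub>R (v - u) + b *\<^sub>R (w - u)) = d \<bullet> u + a * p + b * q" for a b
    by (simp add: p_def q_def inner_add_right inner_diff_right)
  show ?thesis (is "?L = ?R")
  proof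
    show "?L \<subseteq> ?R"
    proof
      fix x assume "x \<in> ?L"
      then obtain a b where ab: "0 \<le> a" "0 \<le> b" "a + b \<le> 1" "x = u + a *\<^sub>R (v - u) + b *\<^sub>R (w - u)"
        and le: "d \<bullet> x \<le> s" by (auto simp: convex_hull_3_alt)
      have le': "a * p + b * q \<le> e" using le unfolding ab(4) level e_def by simp
      show "x \<in> ?R"
      \<comment> \<open>For \<open>e = 0\<close> the cut is the single point \<open>u\<close>, and
        rescaling would divide by zero.\<close>
      proof (cases "e = 0")
        case True
        have "a * p \<ge> 0" "b * q \<ge> 0" using ab pq by auto
        then have "a * p = 0" "b * q = 0" using le' True by linarith+
        then have "a = 0" "b = 0" using pq by auto
        then show ?thesis using ab by (auto intro: hull_inc)
      next
        case False
        then have e: "e > 0" using pq by auto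
        have "a * p / e + b * q / e \<le> 1" using le' e by (simp add: add_divide_distrib[symmetric])
        moreover have "x = u + (a * p / e) *\<^sub>R ((u + (e / p) *\<^sub>R (v - u)) - u)
            + (b * q / e) *\<^sub>R ((u + (e / q) *\<^sub>R (w - u)) - u)"
          using ab(4) e pq by simp
        moreover have "0 \<le> a * p / e" "0 \<le> b * q / e" using ab pq e by auto
        ultimately show ?thesis
          unfolding convex_hull_3_alt p_def[symmetric] q_def[symmetric] e_def[symmetric] by blast
      qed
    qed
    show "?R \<subseteq> ?L"
    proof
      fix x assume "x \<in> ?R"
      then obtain a b where ab: "0 \<le> a" "0 \<le> b" "a + b \<le> 1"
        "x = u + a *\<^sub>R ((e / p) *\<^sub>R (v - u)) + b *\<^sub>R ((e / q) *\<^sub>R (w - u))"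
        by (auto simp: convex_hull_3_alt p_def q_def e_def)
      have x: "x = u + (a * (e / p)) *\<^sub>R (v - u) + (b * (e / q)) *\<^sub>R (w - u)" using ab by simp
      have "0 \<le> a * (e / p)" "0 \<le> b * (e / q)" using ab pq by auto
      moreover have "a * (e / p) \<le> a * 1" "b * (e / q) \<le> b * 1"
        using ab pq by (intro mult_left_mono; simp)+
      moreover have "d \<bullet> x = d \<bullet> u + (a + b) * e"
        unfolding x level using pq by (simp add: field_simps)
      moreover have "(a + b) * e \<le> 1 * e" using ab pq by (intro mult_right_mono) auto
      moreover have "x \<in> convex hull {u, v, w}"
        unfolding convex_hull_3_alt mem_Collect_eq
        by (intro exI[of _ "a * (e / p)"] exI[of _ "b * (e / q)"] conjI x) (use calculation ab in linarith)+
      ultimately show "x \<in> ?L" by (simp add: e_def)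
    qed
  qed
qed

lemma lebesgue_measure_triangle:
  fixes u v w :: "real^2"
  shows "measure lebesgue (convex hull {u, v, w}) =
    \<bar>(w $ 1 - u $ 1) * (v $ 2 - u $ 2) - (v $ 1 - u $ 1) * (w $ 2 - u $ 2)\<bar> / 2"
proof -
  have "convex hull {u, v, w} \<in> sets lborel"
    by (simp add: compact_imp_closed compact_convex_hull borel_closed)
  then show ?thesis using content_triangle[of u v w] by (simp add: measure_completion)
qed

lemma content_triangle_corner:
  fixes d u v w :: "real^2"
  assumes "d \<bullet> u < d \<bullet> v" "d \<bullet> u < d \<bullet> w" "d \<bullet> u \<le> s" "s \<le> d \<bullet> v" "s \<le> d \<bullet> w"
  shows "measure lebesgue (convex hull {u, v, w} \<inter> {x. d \<bullet> x \<le> s}) =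
    measure lebesgue (convex hull {u, v, w}) * (s - d \<bullet> u)\<^sup>2 / ((d \<bullet> v - d \<bullet> u) * (d \<bullet> w - d \<bullet> u))"
proof -
  define p q where "p = (s - d \<bullet> u) / (d \<bullet> v - d \<bullet> u)" and "q = (s - d \<bullet> u) / (d \<bullet> w - d \<bullet> u)"
  have pq: "p \<ge> 0" "q \<ge> 0" using assms by (auto simp: p_def q_def)
  have "measure lebesgue (convex hull {u, v, w} \<inter> {x. d \<bullet> x \<le> s}) = 
    \<bar>(p * q) * ((w $ 1 - u $ 1) * (v $ 2 - u $ 2) - (v $ 1 - u $ 1) * (w $ 2 - u $ 2))\<bar> / 2"
    unfolding triangle_corner_cut[OF assms] lebesgue_measure_triangle p_def[symmetric] q_def[symmetric]
    by (simp add: algebra_simps)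
  also have "\<dots> = p * q * measure lebesgue (convex hull {u, v, w})"
    unfolding lebesgue_measure_triangle abs_mult using pq by simp
  finally show ?thesis by (simp add: p_def q_def power2_eq_square)
qed

lemma lmeasurable_triangle: "convex hull {u, v, w} \<in> lmeasurable" for u v w :: "real^2"
  by (intro lmeasurable_compact compact_convex_hull) auto

lemma lmeasurable_Int_halfspace:
  fixes K :: "(real^2) set"
  assumes "K \<in> lmeasurable"
  shows "K \<inter> {x. d \<bullet> x \<le> s} \<in> lmeasurable"
  using assms by (auto intro!: fmeasurable_Int_fmeasurable)

text \<open>The two parts overlap only in a line, which is null. Negating \<open>d\<close> turns the
  part above the line into a part below one, so the corner formula also serves at the highest
  vertex.\<close>

lemma measure_halfspace_complement:
  fixes K :: "(real^2) set"
  assumes "K \<in> lmeasurable" "d \<noteq> 0"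
  shows "measure lebesgue (K \<inter> {x. d \<bullet> x \<le> s}) =
    measure lebesgue K - measure lebesgue (K \<inter> {x. (- d) \<bullet> x \<le> - s})"
proof -
  let ?A = "K \<inter> {x. d \<bullet> x \<le> s}" and ?B = "K \<inter> {x. (- d) \<bullet> x \<le> - s}"
  have "negligible (?A \<inter> ?B)"
    by (rule negligible_subset[OF negligible_hyperplane[of d s]]) (use assms in auto)
  then have "measure lebesgue (?A \<inter> ?B) = 0" by (rule negligible_imp_measure0)
  then have "measure lebesgue (?A \<union> ?B) = measure lebesgue ?A + measure lebesgue ?B"
    using measure_Un3[OF lmeasurable_Int_halfspace[OF assms(1), of d s]
        lmeasurable_Int_halfspace[OF assms(1), of "- d" "- s"]] by linarith
  moreover have "?A \<union> ?B = K" by auto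
  ultimately show ?thesis by simp
qed

section \<open>Jumps of the derivative of the cut area\<close>

definition cut_area :: "real^2 \<Rightarrow> (real^2) set \<Rightarrow> real \<Rightarrow> real" where
  "cut_area d K s = measure lebesgue (K \<inter> {x. d \<bullet> x \<le> s})"

text \<open>The jump at \<open>s\<close> of the derivative of \<open>G\<close>. For \<open>G = cut_area d K\<close> this is the jump of the length of
  the slice of \<open>K\<close> at level \<open>s\<close>, which for a triangle comes from the edges orthogonal to \<open>d\<close>.\<close>
definition slope_jump :: "(real \<Rightarrow> real) \<Rightarrow> real \<Rightarrow> real \<Rightarrow> bool" where
  "slope_jump G s l \<longleftrightarrow> ((\<lambda>\<epsilon>. (G (s + \<epsilon>) + G (s - \<epsilon>) - 2 * G s) / \<epsilon>) \<longlongrightarrow> l) (at_right 0)"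

text \<open>\<open>r1\<close> and \<open>l1\<close> are the right and left derivatives at
  \<open>s\<close>; the quadratic terms of the second difference, divided by
  \<open>\<epsilon>\<close>, vanish in the limit.\<close>

lemma slope_jumpI:
  assumes "\<eta> > 0" "G s = r0"
    and "\<And>\<epsilon>. 0 < \<epsilon> \<Longrightarrow> \<epsilon> < \<eta> \<Longrightarrow> G (s + \<epsilon>) = r0 + r1 * \<epsilon> + r2 * \<epsilon>\<^sup>2"
    and "\<And>\<epsilon>. 0 < \<epsilon> \<Longrightarrow> \<epsilon> < \<eta> \<Longrightarrow> G (s - \<epsilon>) = r0 - l1 * \<epsilon> + l2 * \<epsilon>\<^sup>2"
    and "l = r1 - l1"
  shows "slope_jump G s l"
  unfolding slope_jump_def
proof (rule Lim_transform_eventually)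
  show "((\<lambda>\<epsilon>. r1 - l1 + (r2 + l2) * \<epsilon>) \<longlongrightarrow> l) (at_right 0)"
    unfolding assms by (auto intro!: tendsto_eq_intros)
  have "eventually (\<lambda>\<epsilon>. \<epsilon> \<in> {0<..<\<eta>}) (at_right 0)"
    using \<open>\<eta> > 0\<close> by (rule eventually_at_right_real)
  then show "\<forall>\<^sub>F \<epsilon> in at_right 0. r1 - l1 + (r2 + l2) * \<epsilon> = (G (s + \<epsilon>) + G (s - \<epsilon>) - 2 * G s) / \<epsilon>"
  proof eventually_elim
    case (elim e)
    then have "G (s + e) = r0 + r1 * e + r2 * e\<^sup>2" "G (s - e) = r0 - l1 * e + l2 * e\<^sup>2" "e > 0"
      using assms(3,4) by auto
    then show ?case by (simp add: assms(2) field_simps power2_eq_square)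
  qed
qed

lemma slope_jump_unique: "slope_jump G s l \<Longrightarrow> slope_jump G s l' \<Longrightarrow> l = l'"
  unfolding slope_jump_def by (rule tendsto_unique[rotated]) auto

lemma slope_jump_sum:
  assumes "\<And>i. i \<in> I \<Longrightarrow> slope_jump (G i) s (l i)"
  shows "slope_jump (\<lambda>x. \<Sum>i\<in>I. G i x) s (\<Sum>i\<in>I. l i)"
proof -
  have "((\<lambda>\<epsilon>. \<Sum>i\<in>I. (G i (s + \<epsilon>) + G i (s - \<epsilon>) - 2 * G i s) / \<epsilon>) \<longlongrightarrow> (\<Sum>i\<in>I. l i)) (at_right 0)"
    using assms unfolding slope_jump_def by (intro tendsto_sum) auto
  then show ?thesis
    unfolding slope_jump_def
    by (simp add: sum_divide_distrib[symmetric] sum.distrib sum_subtractf sum_distrib_left)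
qed

text \<open>As the level rises through \<open>s\<close>, the slice gains an edge whose triangle lies
  above it and loses one whose triangle lies below; the sign records which.\<close>

definition edge_jump :: "real^2 \<Rightarrow> real \<Rightarrow> real^2 \<Rightarrow> real^2 \<Rightarrow> real^2 \<Rightarrow> real" where
  "edge_jump d s x y z = (if d \<bullet> x = s \<and> d \<bullet> y = s then dist x y * sgn (d \<bullet> z - s) else 0)"

definition triangle_jump :: "real^2 \<Rightarrow> real \<Rightarrow> real^2 \<Rightarrow> real^2 \<Rightarrow> real^2 \<Rightarrow> real" where
  "triangle_jump d s x y z = edge_jump d s y z x + edge_jump d s z x y + edge_jump d s x y z"

lemma content_triangle_height:
  fixes d u v w :: "real^2"
  assumes "norm d = 1" "d \<bullet> u = d \<bullet> v"
  shows "2 * measure lebesgue (convex hull {u, v, w}) = dist u v * \<bar>d \<bullet> w - d \<bullet> u\<bar>"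
proof -
  define x y where "x = v - u" and "y = w - u"
  have d: "d$1 * d$1 + d$2 * d$2 = 1"
    using assms(1) by (simp add: norm_eq_1 inner_vec_def sum_2)
  have dx: "d$1 * x$1 + d$2 * x$2 = 0"
    using assms(2) by (simp add: x_def inner_vec_def sum_2 algebra_simps)
  \<comment> \<open>The edge vector \<open>x\<close> is orthogonal to the unit vector
    \<open>d\<close>, so it is \<open>d\<close> turned by a right angle and scaled; \<open>t\<close>
    is this signed length.\<close>
  define t where "t = d$1 * x$2 - d$2 * x$1"
  have x: "x$1 = - t * d$2" "x$2 = t * d$1"
    using d dx unfolding t_def by algebra+
  have "(dist u v)\<^sup>2 = t\<^sup>2"
    unfolding dist_norm norm_minus_commute[of u] x_def[symmetric] power2_norm_eq_inner
    using d by (simp add: inner_vec_def sum_2 x power2_eq_square) algebra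
  then have "dist u v = \<bar>t\<bar>" by (metis abs_of_nonneg power2_eq_iff_nonneg abs_ge_zero power2_abs zero_le_dist)
  moreover have "2 * measure lebesgue (convex hull {u, v, w}) = \<bar>y$1 * x$2 - x$1 * y$2\<bar>"
    by (simp add: lebesgue_measure_triangle x_def y_def)
  moreover have "y$1 * x$2 - x$1 * y$2 = t * (d \<bullet> y)"
    by (simp add: x inner_vec_def sum_2 algebra_simps)
  moreover have "d \<bullet> y = d \<bullet> w - d \<bullet> u" by (simp add: y_def inner_diff_right)
  ultimately show ?thesis by (simp add: abs_mult)
qed

lemma cut_area_low:
  assumes "d \<bullet> u < d \<bullet> v" "d \<bullet> v \<le> d \<bullet> w" "d \<bullet> u \<le> s" "s \<le> d \<bullet> v"
  shows "cut_area d (convex hull {u, v, w}) s =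
    measure lebesgue (convex hull {u, v, w}) * (s - d \<bullet> u)\<^sup>2 / ((d \<bullet> v - d \<bullet> u) * (d \<bullet> w - d \<bullet> u))"
  unfolding cut_area_def using assms by (intro content_triangle_corner) auto

text \<open>The part above level \<open>s\<close> is the corner at \<open>w\<close>, so its area is
  subtracted from the whole.\<close>

lemma cut_area_high:
  assumes "d \<bullet> u \<le> d \<bullet> v" "d \<bullet> v < d \<bullet> w" "d \<bullet> v \<le> s" "s \<le> d \<bullet> w"
  shows "cut_area d (convex hull {u, v, w}) s =
    measure lebesgue (convex hull {u, v, w}) - measure lebesgue (convex hull {u, v, w}) *
      (d \<bullet> w - s)\<^sup>2 / ((d \<bullet> w - d \<bullet> v) * (d \<bullet> w - d \<bullet> u))"
proof -
  have "d \<noteq> 0" using assms by auto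
  have "{w, v, u} = {u, v, w}" by auto
  with content_triangle_corner[of "- d" w v u "- s"] assms
  have "measure lebesgue (convex hull {u, v, w} \<inter> {x. (- d) \<bullet> x \<le> - s}) =
    measure lebesgue (convex hull {u, v, w}) * (d \<bullet> w - s)\<^sup>2 / ((d \<bullet> w - d \<bullet> v) * (d \<bullet> w - d \<bullet> u))"
    by simp
  then show ?thesis
    unfolding cut_area_def
    using measure_halfspace_complement[OF lmeasurable_triangle \<open>d \<noteq> 0\<close>, of u v w s] by simp
qed

lemma triangle_in_slab:
  fixes d :: "real^2"
  assumes "x \<in> convex hull {u, v, w}" "d \<bullet> u \<le> d \<bullet> v" "d \<bullet> v \<le> d \<bullet> w"
  shows "d \<bullet> u \<le> d \<bullet> x" "d \<bullet> x \<le> d \<bullet> w"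
proof -
  have "convex hull {u, v, w} \<subseteq> {x. d \<bullet> u \<le> d \<bullet> x}" "convex hull {u, v, w} \<subseteq> {x. d \<bullet> x \<le> d \<bullet> w}"
    using assms convex_halfspace_ge[of "d \<bullet> u" d] convex_halfspace_le[of d "d \<bullet> w"]
    by (intro hull_minimal; auto)+
  then show "d \<bullet> u \<le> d \<bullet> x" "d \<bullet> x \<le> d \<bullet> w" using assms(1) by auto
qed

lemma cut_area_below:
  assumes "d \<bullet> u \<le> d \<bullet> v" "d \<bullet> v \<le> d \<bullet> w" "s < d \<bullet> u"
  shows "cut_area d (convex hull {u, v, w}) s = 0"
proof -
  have "convex hull {u, v, w} \<inter> {x. d \<bullet> x \<le> s} = {}"
    using triangle_in_slab[of _ u v w d] assms by fastforce
  then show ?thesis by (simp add: cut_area_def)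
qed

lemma cut_area_above:
  assumes "d \<bullet> u \<le> d \<bullet> v" "d \<bullet> v \<le> d \<bullet> w" "d \<bullet> w \<le> s"
  shows "cut_area d (convex hull {u, v, w}) s = measure lebesgue (convex hull {u, v, w})"
proof -
  have "convex hull {u, v, w} \<inter> {x. d \<bullet> x \<le> s} = convex hull {u, v, w}"
    using triangle_in_slab[of _ u v w d] assms by fastforce
  then show ?thesis by (simp add: cut_area_def)
qed

text \<open>The cut area is piecewise 0, \<open>k * (t - a)\<^sup>2\<close>,
  \<open>A - l * (c - t)\<^sup>2\<close> and \<open>A\<close>. These pieces join with equal
  derivatives except where an edge is orthogonal to \<open>d\<close>, at the bottom
  (\<open>a = b\<close>) or at the top (\<open>b = c\<close>).\<close>

lemma slope_jump_triangle_sorted: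
  fixes d u v w :: "real^2"
  assumes "norm d = 1" "d \<bullet> u \<le> d \<bullet> v" "d \<bullet> v \<le> d \<bullet> w" "d \<bullet> u < d \<bullet> w"
  shows "slope_jump (cut_area d (convex hull {u, v, w})) s (triangle_jump d s u v w)"
proof -
  define A where "A = measure lebesgue (convex hull {u, v, w})"
  define a b c where "a = d \<bullet> u" and "b = d \<bullet> v" and "c = d \<bullet> w"
  define G where "G = cut_area d (convex hull {u, v, w})"
  define k where "k = A / ((b - a) * (c - a))"
  define l where "l = A / ((c - b) * (c - a))"
  have ord: "a \<le> b" "b \<le> c" "a < c" using assms by (auto simp: a_def b_def c_def)
  have below: "G t = 0" if "t < a" for t
    using that assms cut_area_below unfolding a_def G_def by blast
  have above: "G t = A" if "c \<le> t" for t
    using that assms cut_area_above unfolding c_def G_def A_def by blast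
  have low: "G t = k * (t - a)\<^sup>2" if "a < b" "a \<le> t" "t \<le> b" for t
    using that assms cut_area_low[of d u v w t] unfolding a_def b_def c_def G_def k_def A_def by simp
  have high: "G t = A - l * (c - t)\<^sup>2" if "b < c" "b \<le> t" "t \<le> c" for t
    using that assms cut_area_high[of d u v w t] unfolding a_def b_def c_def G_def l_def A_def by simp
  have J: "triangle_jump d s u v w = (if b = s \<and> c = s then - dist v w else 0)
      + (if a = s \<and> b = s then dist u v else 0)"
    using assms unfolding triangle_jump_def edge_jump_def a_def[symmetric] b_def[symmetric] c_def[symmetric]
    by auto
  \<comment> \<open>All positions of \<open>s\<close> relative to the three vertex levels; only the
    third and the eighth give a nonzero jump.\<close>
  consider "s < a" | "s = a" "a < b" | "s = a" "a = b" | "a < s" "s < b" | "s = b" "a < b" "b < c"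
    | "b < s" "s < c" | "s = c" "b < c" | "s = c" "b = c" | "c < s"
    using ord by linarith
  then have "slope_jump G s (triangle_jump d s u v w)"
  proof cases
    case 1
    show ?thesis
      by (rule slope_jumpI[of "a - s" _ _ 0 0 0 0 0]) (use 1 ord J in \<open>auto simp: below\<close>)
  next
    case 2
    show ?thesis
      by (rule slope_jumpI[of "b - a" _ _ 0 0 k 0 0]) (use 2 ord J in \<open>auto simp: below low\<close>)
  next
    case 3
    \<comment> \<open>Base times height identifies the right derivative
      \<open>2 * l * (c - a)\<close> with the length of the bottom edge.\<close>
    have "2 * A = dist u v * (c - a)"
      using content_triangle_height[of d u v w] assms 3 ord by (simp add: A_def a_def b_def c_def)
    then have "dist u v = 2 * A / (c - a)" using ord by (simp add: field_simps)
    then have l: "l * (c - a)\<^sup>2 = A" "dist u v = 2 * l * (c - a)"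
      using ord 3 by (simp_all add: l_def power2_eq_square)
    show ?thesis
    proof (rule slope_jumpI[of "c - a" _ _ 0 "2 * l * (c - a)" "- l" 0 0])
      fix e :: real assume "0 < e" "e < c - a"
      then have "G (s + e) = A - l * (c - (s + e))\<^sup>2" using 3 ord by (intro high) auto
      also have "\<dots> = 0 + 2 * l * (c - a) * e + - l * e\<^sup>2"
        unfolding l(1)[symmetric] using 3 by (simp add: power2_eq_square algebra_simps)
      finally show "G (s + e) = 0 + 2 * l * (c - a) * e + - l * e\<^sup>2" .
    qed (use 3 ord J l in \<open>auto simp: below high\<close>)
  next
    case 4
    show ?thesis
    proof (rule slope_jumpI[of "min (s - a) (b - s)" _ _ "k * (s - a)\<^sup>2" "2 * k * (s - a)" k "2 * k * (s - a)" k])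
      fix e :: real assume e: "0 < e" "e < min (s - a) (b - s)"
      then have "G (s + e) = k * (s + e - a)\<^sup>2" "G (s - e) = k * (s - e - a)\<^sup>2"
        using 4 by (auto intro!: low)
      then show "G (s + e) = k * (s - a)\<^sup>2 + 2 * k * (s - a) * e + k * e\<^sup>2"
        "G (s - e) = k * (s - a)\<^sup>2 - 2 * k * (s - a) * e + k * e\<^sup>2"
        by (auto simp: power2_eq_square algebra_simps)
    qed (use 4 ord J in \<open>auto simp: low\<close>)
  next
    case 5
    \<comment> \<open>At the middle vertex the two quadratics agree in derivative
      (\<open>eq\<close>) and in value (\<open>eq'\<close>).\<close>
    have eq: "2 * k * (b - a) = 2 * l * (c - b)" using 5 by (simp add: k_def l_def)
    have "k * (b - a)\<^sup>2 = A * (b - a) / (c - a)" "l * (c - b)\<^sup>2 = A * (c - b) / (c - a)"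
      using 5 by (auto simp: k_def l_def power2_eq_square)
    moreover have "A * (b - a) / (c - a) = A - A * (c - b) / (c - a)"
      using 5 by (simp add: field_simps)
    ultimately have eq': "k * (b - a)\<^sup>2 = A - l * (c - b)\<^sup>2" by simp
    show ?thesis
    proof (rule slope_jumpI[of "min (b - a) (c - b)" _ _ "k * (b - a)\<^sup>2" "2 * k * (b - a)" "- l" "2 * k * (b - a)" k])
      fix e :: real assume e: "0 < e" "e < min (b - a) (c - b)"
      then have G: "G (s + e) = A - l * (c - (b + e))\<^sup>2" "G (s - e) = k * (b - e - a)\<^sup>2"
        using 5 by (auto intro!: low high)
      show "G (s + e) = k * (b - a)\<^sup>2 + 2 * k * (b - a) * e + - l * e\<^sup>2"
        unfolding eq' eq G by (simp add: power2_eq_square algebra_simps)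
      show "G (s - e) = k * (b - a)\<^sup>2 - 2 * k * (b - a) * e + k * e\<^sup>2"
        unfolding G by (simp add: power2_eq_square algebra_simps)
    qed (use 5 ord J in \<open>auto simp: low\<close>)
  next
    case 6
    show ?thesis
    proof (rule slope_jumpI[of "min (s - b) (c - s)" _ _ "A - l * (c - s)\<^sup>2" "2 * l * (c - s)" "- l" "2 * l * (c - s)" "- l"])
      fix e :: real assume e: "0 < e" "e < min (s - b) (c - s)"
      then have "G (s + e) = A - l * (c - (s + e))\<^sup>2" "G (s - e) = A - l * (c - (s - e))\<^sup>2"
        using 6 by (auto intro!: high)
      then show "G (s + e) = A - l * (c - s)\<^sup>2 + 2 * l * (c - s) * e + - l * e\<^sup>2"
        "G (s - e) = A - l * (c - s)\<^sup>2 - 2 * l * (c - s) * e + - l * e\<^sup>2"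
        by (auto simp: power2_eq_square algebra_simps)
    qed (use 6 ord J in \<open>auto simp: high\<close>)
  next
    case 7
    show ?thesis
      by (rule slope_jumpI[of "c - b" _ _ A 0 0 0 "- l"]) (use 7 ord J in \<open>auto simp: above high\<close>)
  next
    case 8
    have "2 * A = dist v w * (c - a)"
      using content_triangle_height[of d v w u] assms 8 ord
      by (simp add: A_def a_def b_def c_def insert_commute)
    then have "dist v w = 2 * A / (c - a)" using ord by (simp add: field_simps)
    then have k: "k * (c - a)\<^sup>2 = A" "dist v w = 2 * k * (c - a)"
      using ord 8 by (simp_all add: k_def power2_eq_square)
    show ?thesis
    proof (rule slope_jumpI[of "c - a" _ _ A 0 0 "2 * k * (c - a)" k])
      fix e :: real assume "0 < e" "e < c - a"
      then have "G (s - e) = k * (s - e - a)\<^sup>2" using 8 ord by (intro low) auto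
      also have "\<dots> = A - 2 * k * (c - a) * e + k * e\<^sup>2"
        unfolding k(1)[symmetric] using 8 by (simp add: power2_eq_square algebra_simps)
      finally show "G (s - e) = A - 2 * k * (c - a) * e + k * e\<^sup>2" .
    qed (use 8 ord J k in \<open>auto simp: above\<close>)
  next
    case 9
    show ?thesis
      by (rule slope_jumpI[of "s - c" _ _ A 0 0 0 0]) (use 9 ord J in \<open>auto simp: above\<close>)
  qed
  then show ?thesis by (simp add: G_def)
qed

lemma edge_jump_commute: "edge_jump d s y x z = edge_jump d s x y z"
  unfolding edge_jump_def by (subst dist_commute) (simp add: conj_commute)

lemma triangle_jump_swap:
  "triangle_jump d s v u w = triangle_jump d s u v w"
  "triangle_jump d s u w v = triangle_jump d s u v w"
  unfolding triangle_jump_def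
  using edge_jump_commute[of d s u w v] edge_jump_commute[of d s w v u] edge_jump_commute[of d s v u w]
  by linarith+

lemma collinear_if_same_level:
  fixes d u v w :: "real^2"
  assumes "d \<noteq> 0" "d \<bullet> u = d \<bullet> v" "d \<bullet> w = d \<bullet> v"
  shows "collinear {u, v, w}"
proof -
  have "{u, v, w} \<subseteq> {x. d \<bullet> x = d \<bullet> v}" using assms by auto
  moreover have "collinear {x. d \<bullet> x = d \<bullet> v}"
    using assms(1) by (simp add: collinear_aff_dim aff_dim_hyperplane)
  ultimately show ?thesis by (rule collinear_subset[rotated])
qed

text \<open>Hull and jump are symmetric in the vertices, so these may be sorted by level;
  noncollinearity makes the lowest and the highest level differ.\<close>

lemma slope_jump_triangle:
  fixes d u v w :: "real^2"
  assumes d: "norm d = 1" and nc: "\<not> collinear {u, v, w}"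
  shows "slope_jump (cut_area d (convex hull {u, v, w})) s (triangle_jump d s u v w)"
proof -
  have *: "d \<bullet> u < d \<bullet> w \<or> d \<bullet> w < d \<bullet> u \<or> d \<bullet> v < d \<bullet> w \<or> d \<bullet> w < d \<bullet> v"
    using collinear_if_same_level[of d u v w] d nc by fastforce
  have perm: "{v, u, w} = {u, v, w}" "{u, w, v} = {u, v, w}" "{v, w, u} = {u, v, w}"
    "{w, u, v} = {u, v, w}" "{w, v, u} = {u, v, w}" by auto
  show ?thesis
  proof (rule le_cases3[of "d \<bullet> u" "d \<bullet> v" "d \<bullet> w"])
    assume le: "d \<bullet> u \<le> d \<bullet> v" "d \<bullet> v \<le> d \<bullet> w"
    then have "d \<bullet> u < d \<bullet> w" using * by linarith
    from slope_jump_triangle_sorted[OF d le this, of s] show ?thesis .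
  next
    assume le: "d \<bullet> v \<le> d \<bullet> u" "d \<bullet> u \<le> d \<bullet> w"
    then have "d \<bullet> v < d \<bullet> w" using * by linarith
    from slope_jump_triangle_sorted[OF d le this, of s] show ?thesis
      unfolding perm triangle_jump_swap(1)[of d s v u] .
  next
    assume le: "d \<bullet> u \<le> d \<bullet> w" "d \<bullet> w \<le> d \<bullet> v"
    then have "d \<bullet> u < d \<bullet> v" using * by linarith
    from slope_jump_triangle_sorted[OF d le this, of s] show ?thesis
      unfolding perm triangle_jump_swap(2)[of d s u w v] .
  next
    assume le: "d \<bullet> w \<le> d \<bullet> u" "d \<bullet> u \<le> d \<bullet> v"
    then have "d \<bullet> w < d \<bullet> v" using * by linarith
    from slope_jump_triangle_sorted[OF d le this, of s] show ?thesis
      unfolding perm triangle_jump_swap(1)[of d s w u v] triangle_jump_swap(2)[of d s u w v] .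
  next
    assume le: "d \<bullet> v \<le> d \<bullet> w" "d \<bullet> w \<le> d \<bullet> u"
    then have "d \<bullet> v < d \<bullet> u" using * by linarith
    from slope_jump_triangle_sorted[OF d le this, of s] show ?thesis
      unfolding perm triangle_jump_swap(2)[of d s v w u] triangle_jump_swap(1)[of d s v u w] .
  next
    assume le: "d \<bullet> w \<le> d \<bullet> v" "d \<bullet> v \<le> d \<bullet> u"
    then have "d \<bullet> w < d \<bullet> u" using * by linarith
    from slope_jump_triangle_sorted[OF d le this, of s] show ?thesis
      unfolding perm triangle_jump_swap(1)[of d s w v u] triangle_jump_swap(2)[of d s v w u]
        triangle_jump_swap(1)[of d s v u w] .
  qed
qed

subsection \<open>Edge lengths weighted by their normals\<close>

text \<open>Two tiles with disjoint interiors meet only in their frontiers, which are null for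
  convex sets. The set \<open>H\<close> lets one identity serve both for full areas and for cut
  areas.\<close>

lemma measure_tiling:
  fixes F :: "(real^2) set set"
  assumes "finite F" "\<And>t. t \<in> F \<Longrightarrow> compact t" "\<And>t. t \<in> F \<Longrightarrow> convex t"
    and disj: "pairwise (\<lambda>s t. disjnt (interior s) (interior t)) F"
    and H: "\<And>t. t \<in> F \<Longrightarrow> t \<inter> H \<in> lmeasurable"
  shows "measure lebesgue (\<Union>F \<inter> H) = (\<Sum>t\<in>F. measure lebesgue (t \<inter> H))"
proof -
  have "negligible ((s \<inter> H) \<inter> (t \<inter> H))" if "s \<in> F" "t \<in> F" "s \<noteq> t" for s t
  proof -
    have "disjnt (interior s) (interior t)" using that disj by (auto simp: pairwise_def)
    moreover have "closed s" "closed t" using assms(2) that by (auto intro: compact_imp_closed)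
    ultimately have "(s \<inter> H) \<inter> (t \<inter> H) \<subseteq> frontier s \<union> frontier t"
      by (auto simp: frontier_def disjnt_def)
    moreover have "negligible (frontier s \<union> frontier t)"
      using assms(3) that by (intro negligible_Un negligible_convex_frontier)
    ultimately show ?thesis by (rule negligible_subset[rotated])
  qed
  then have "measure lebesgue (\<Union>((\<lambda>t. t \<inter> H) ` F)) = (\<Sum>t\<in>F. measure lebesgue (t \<inter> H))"
    using assms by (intro measure_negligible_finite_Union_image) (auto simp: pairwise_def)
  moreover have "\<Union>((\<lambda>t. t \<inter> H) ` F) = \<Union>F \<inter> H" by auto
  ultimately show ?thesis by simp
qed

definition outer_normal :: "real^2 \<Rightarrow> real^2 \<Rightarrow> real^2 \<Rightarrow> real^2 \<Rightarrow> bool" where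
  "outer_normal n x y z \<longleftrightarrow> norm n = 1 \<and> n \<bullet> x = n \<bullet> y \<and> n \<bullet> z < n \<bullet> x"

text \<open>In the plane, the vectors orthogonal to \<open>x - y \<noteq> 0\<close> form a line,
  which contains just two unit vectors.\<close>

lemma unit_normal_unique:
  fixes n d x y :: "real^2"
  assumes "norm n = 1" "norm d = 1" "n \<bullet> x = n \<bullet> y" "d \<bullet> x = d \<bullet> y" "x \<noteq> y"
  shows "d = n \<or> d = - n"
proof -
  define v where "v = x - y"
  have v: "n$1 * v$1 + n$2 * v$2 = 0" "d$1 * v$1 + d$2 * v$2 = 0"
    using assms by (auto simp: v_def inner_vec_def sum_2 algebra_simps)
  have u: "n$1 * n$1 + n$2 * n$2 = 1" "d$1 * d$1 + d$2 * d$2 = 1"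
    using assms by (auto simp: norm_eq_1 inner_vec_def sum_2)
  have "v$1 \<noteq> 0 \<or> v$2 \<noteq> 0"
    using assms(5) by (auto simp: v_def vec_eq_iff forall_2)
  moreover have "v$1 * (n$1 * d$2 - n$2 * d$1) = 0" "v$2 * (n$1 * d$2 - n$2 * d$1) = 0"
    using v by algebra+
  ultimately have c: "n$1 * d$2 = n$2 * d$1" by auto
  define k where "k = n$1 * d$1 + n$2 * d$2"
  have "k * k = 1" using u c unfolding k_def by algebra
  then have "k = 1 \<or> k = -1" by (simp add: square_eq_1_iff)
  moreover have "d$1 = k * n$1" "d$2 = k * n$2" using u c unfolding k_def by algebra+
  ultimately show ?thesis by (auto simp: vec_eq_iff forall_2)
qed

text \<open>Only \<open>n\<close> and \<open>- n\<close> are orthogonal to the edge, each at a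
  single level. The jump is minus the length for \<open>n\<close>, as \<open>z\<close> lies below,
  and plus the length for \<open>- n\<close>; since \<open>g\<close> is odd, the two terms add up,
  whence the factor \<open>- 2\<close>.\<close>

lemma edge_jump_weighted_sum:
  fixes g :: "real^2 \<Rightarrow> real"
  assumes n: "outer_normal n x y z" and xy: "x \<noteq> y"
    and odd: "\<And>d. g (- d) = - g d"
    and D: "finite D" "\<And>d. d \<in> D \<Longrightarrow> norm d = 1" "n \<in> D" "- n \<in> D"
    and S: "finite S" "\<And>d. d \<in> D \<Longrightarrow> d \<bullet> x \<in> S"
  shows "(\<Sum>d\<in>D. \<Sum>s\<in>S. g d * edge_jump d s x y z) = - 2 * dist x y * g n"
proof -
  define h where "h d = (if d \<bullet> x = d \<bullet> y then g d * dist x y * sgn (d \<bullet> z - d \<bullet> x) else 0)" for d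
  have "n \<noteq> 0" using n by (auto simp: outer_normal_def)
  then have nn: "n \<noteq> - n" by (metis eq_neg_iff_add_eq_0 scaleR_2 scaleR_eq_0_iff zero_neq_numeral)
  have "(\<Sum>s\<in>S. g d * edge_jump d s x y z) = h d" if "d \<in> D" for d
  proof -
    have "(\<Sum>s\<in>S. g d * edge_jump d s x y z) = (\<Sum>s\<in>S. if s = d \<bullet> x then h d else 0)"
      by (intro sum.cong) (auto simp: edge_jump_def h_def)
    also have "\<dots> = h d" using S that by simp
    finally show ?thesis .
  qed
  then have "(\<Sum>d\<in>D. \<Sum>s\<in>S. g d * edge_jump d s x y z) = (\<Sum>d\<in>D. h d)" by simp
  also have "\<dots> = (\<Sum>d\<in>{n, - n}. h d)"
  proof (rule sum.mono_neutral_right)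
    show "\<forall>d\<in>D - {n, - n}. h d = 0"
      using unit_normal_unique[of n _ x y] n D(2) xy by (auto simp: h_def outer_normal_def)
  qed (use D in auto)
  also have "\<dots> = - 2 * dist x y * g n"
    using n nn odd by (simp add: h_def outer_normal_def)
  finally show ?thesis .
qed

definition triangle_normals where
  "triangle_normals p q r n1 n2 n3 \<longleftrightarrow>
     outer_normal n1 q r p \<and> outer_normal n2 r p q \<and> outer_normal n3 p q r"

lemma triangle_jump_weighted_sum:
  fixes g :: "real^2 \<Rightarrow> real"
  assumes "triangle_normals p q r n1 n2 n3" and nc: "\<not> collinear {p, q, r}"
    and "\<And>d. g (- d) = - g d"
    and "finite D" "\<And>d. d \<in> D \<Longrightarrow> norm d = 1" "{n1, n2, n3, - n1, - n2, - n3} \<subseteq> D"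
    and "finite S" "\<And>d x. d \<in> D \<Longrightarrow> x \<in> {p, q, r} \<Longrightarrow> d \<bullet> x \<in> S"
  shows "(\<Sum>d\<in>D. \<Sum>s\<in>S. g d * triangle_jump d s p q r) =
    - 2 * (dist q r * g n1 + dist r p * g n2 + dist p q * g n3)"
proof -
  have ne: "q \<noteq> r" "r \<noteq> p" "p \<noteq> q" using nc by (auto simp: insert_commute)
  have "(\<Sum>d\<in>D. \<Sum>s\<in>S. g d * triangle_jump d s p q r) =
    (\<Sum>d\<in>D. \<Sum>s\<in>S. g d * edge_jump d s q r p) + (\<Sum>d\<in>D. \<Sum>s\<in>S. g d * edge_jump d s r p q)
    + (\<Sum>d\<in>D. \<Sum>s\<in>S. g d * edge_jump d s p q r)"
    by (simp add: triangle_jump_def distrib_left sum.distrib)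
  also have "(\<Sum>d\<in>D. \<Sum>s\<in>S. g d * edge_jump d s q r p) = - 2 * dist q r * g n1"
    using assms ne by (intro edge_jump_weighted_sum) (auto simp: triangle_normals_def)
  also have "(\<Sum>d\<in>D. \<Sum>s\<in>S. g d * edge_jump d s r p q) = - 2 * dist r p * g n2"
    using assms ne by (intro edge_jump_weighted_sum) (auto simp: triangle_normals_def)
  also have "(\<Sum>d\<in>D. \<Sum>s\<in>S. g d * edge_jump d s p q r) = - 2 * dist p q * g n3"
    using assms ne by (intro edge_jump_weighted_sum) (auto simp: triangle_normals_def)
  finally show ?thesis by (simp add: algebra_simps)
qed

section \<open>Additivity over a tiling, with a chosen labelling of the vertices of every
  tile\<close>

locale triangle_tiling =
  fixes F :: "(real^2) set set" and p q r :: "(real^2) set \<Rightarrow> real^2" and A B C :: "real^2"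
  assumes finite_F: "finite F"
    and tile: "\<And>t. t \<in> F \<Longrightarrow> t = convex hull {p t, q t, r t}"
    and tile_nondegenerate: "\<And>t. t \<in> F \<Longrightarrow> \<not> collinear {p t, q t, r t}"
    and Union_F: "\<Union>F = convex hull {A, B, C}"
    and nondegenerate_ABC: "\<not> collinear {A, B, C}"
    and interiors: "pairwise (\<lambda>s t. disjnt (interior s) (interior t)) F"
begin

lemma compact_tile: "t \<in> F \<Longrightarrow> compact t"
  by (subst tile) (auto intro: compact_convex_hull)

lemma convex_tile: "t \<in> F \<Longrightarrow> convex t"
  by (subst tile) auto

lemma area_sum: "measure lebesgue (convex hull {A, B, C}) = (\<Sum>t\<in>F. measure lebesgue t)"
  using measure_tiling[OF finite_F compact_tile convex_tile interiors, of UNIV]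
  by (simp add: Union_F lmeasurable_compact compact_tile)

lemma cut_area_sum: "cut_area d (convex hull {A, B, C}) s = (\<Sum>t\<in>F. cut_area d t s)"
  unfolding cut_area_def Union_F[symmetric]
  by (intro measure_tiling finite_F compact_tile convex_tile interiors)
    (auto intro: lmeasurable_Int_halfspace lmeasurable_compact compact_tile)

text \<open>Cut areas add up at every level, and the jump, being a limit, is unique and compatible
  with finite sums.\<close>

lemma triangle_jump_sum:
  assumes "norm d = 1"
  shows "triangle_jump d s A B C = (\<Sum>t\<in>F. triangle_jump d s (p t) (q t) (r t))"
proof (rule slope_jump_unique)
  show "slope_jump (cut_area d (convex hull {A, B, C})) s (triangle_jump d s A B C)"
    using slope_jump_triangle[OF assms nondegenerate_ABC] .
  have "slope_jump (\<lambda>x. \<Sum>t\<in>F. cut_area d t x) s (\<Sum>t\<in>F. triangle_jump d s (p t) (q t) (r t))"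
    using slope_jump_triangle[OF assms tile_nondegenerate, of _ s]
    by (intro slope_jump_sum) (simp flip: tile)
  then show "slope_jump (cut_area d (convex hull {A, B, C})) s
      (\<Sum>t\<in>F. triangle_jump d s (p t) (q t) (r t))"
    by (simp flip: cut_area_sum)
qed

text \<open>Weight the identity of jumps by \<open>g d\<close> and sum over a finite set
  \<open>D\<close> of directions and a finite set \<open>S\<close> of levels that include all
  relevant ones. Each triangle then contributes \<open>- 2\<close> times its weighted edge
  sum.\<close>

lemma normal_weight_sum:
  fixes g :: "real^2 \<Rightarrow> real"
  assumes odd: "\<And>d. g (- d) = - g d"
    and ABC: "triangle_normals A B C k1 k2 k3"
    and tiles: "\<And>t. t \<in> F \<Longrightarrow> triangle_normals (p t) (q t) (r t) (n1 t) (n2 t) (n3 t)"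
  shows "dist B C * g k1 + dist C A * g k2 + dist A B * g k3 =
    (\<Sum>t\<in>F. dist (q t) (r t) * g (n1 t) + dist (r t) (p t) * g (n2 t) + dist (p t) (q t) * g (n3 t))"
proof -
  define D' where "D' = {k1, k2, k3} \<union> n1 ` F \<union> n2 ` F \<union> n3 ` F"
  define D where "D = D' \<union> uminus ` D'"
  define V where "V = {A, B, C} \<union> p ` F \<union> q ` F \<union> r ` F"
  define S where "S = (\<lambda>(d, x). d \<bullet> x) ` (D \<times> V)"
  have fin: "finite D" "finite S" using finite_F by (auto simp: D'_def D_def V_def S_def)
  have unit: "norm d = 1" if "d \<in> D" for d
    using that ABC tiles by (auto simp: D_def D'_def triangle_normals_def outer_normal_def)
  have S: "d \<bullet> x \<in> S" if "d \<in> D" "x \<in> V" for d x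
    using that by (auto simp: S_def)
  have sub: "{k1, k2, k3, - k1, - k2, - k3} \<subseteq> D" "{A, B, C} \<subseteq> V"
    "\<And>t. t \<in> F \<Longrightarrow> {n1 t, n2 t, n3 t, - n1 t, - n2 t, - n3 t} \<subseteq> D"
    "\<And>t. t \<in> F \<Longrightarrow> {p t, q t, r t} \<subseteq> V"
    by (auto simp: D_def D'_def V_def)
  have "- 2 * (dist B C * g k1 + dist C A * g k2 + dist A B * g k3) =
    (\<Sum>d\<in>D. \<Sum>s\<in>S. g d * triangle_jump d s A B C)"
    by (rule triangle_jump_weighted_sum[symmetric, OF ABC nondegenerate_ABC])
      (use odd fin unit S sub in auto)
  also have "\<dots> = (\<Sum>d\<in>D. \<Sum>s\<in>S. \<Sum>t\<in>F. g d * triangle_jump d s (p t) (q t) (r t))"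
    using unit by (intro sum.cong refl) (simp add: triangle_jump_sum sum_distrib_left)
  also have "\<dots> = (\<Sum>t\<in>F. \<Sum>d\<in>D. \<Sum>s\<in>S. g d * triangle_jump d s (p t) (q t) (r t))"
    by (subst sum.swap[of _ _ S], subst sum.swap) simp
  also have "\<dots> = (\<Sum>t\<in>F. - 2 * (dist (q t) (r t) * g (n1 t) + dist (r t) (p t) * g (n2 t)
      + dist (p t) (q t) * g (n3 t)))"
  proof (rule sum.cong[OF refl])
    fix t assume "t \<in> F"
    then show "(\<Sum>d\<in>D. \<Sum>s\<in>S. g d * triangle_jump d s (p t) (q t) (r t)) =
      - 2 * (dist (q t) (r t) * g (n1 t) + dist (r t) (p t) * g (n2 t) + dist (p t) (q t) * g (n3 t))"
      by (intro triangle_jump_weighted_sum tiles tile_nondegenerate)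
        (use odd fin unit S sub in auto)
  qed
  finally show ?thesis unfolding sum_distrib_left[symmetric] by (subst (asm) mult_left_cancel) auto
qed

lemma tile_vertex_in: 
  assumes "t \<in> F" "x \<in> {p t, q t, r t}"
  shows "x \<in> convex hull {A, B, C}"
  using assms tile[OF assms(1)] Union_F by (metis UnionI hull_inc)

text \<open>All tiles lie on the inner side of the line \<open>BC\<close>, so no two of the jumps at that level cancel.\<close>
lemma side_decomposition:
  assumes n: "outer_normal n B C A"
    and len: "\<And>t. t \<in> F \<Longrightarrow> dist (q t) (r t) = a" "\<And>t. t \<in> F \<Longrightarrow> dist (r t) (p t) = b"
      "\<And>t. t \<in> F \<Longrightarrow> dist (p t) (q t) = c"
  shows "\<exists>(x::nat) (y::nat) (z::nat). dist B C = x * a + y * b + z * c"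
proof -
  define s where "s = n \<bullet> B"
  have n': "norm n = 1" "n \<bullet> B = s" "n \<bullet> C = s" "n \<bullet> A < s"
    using n by (auto simp: outer_normal_def s_def)
  define on where "on x y = (if n \<bullet> x = s \<and> n \<bullet> y = s then 1 else 0 :: nat)" for x y
  have below: "n \<bullet> x \<le> s" if "x \<in> convex hull {A, B, C}" for x
  proof -
    have "convex hull {A, B, C} \<subseteq> {x. n \<bullet> x \<le> s}"
      using n' by (intro hull_minimal convex_halfspace_le) auto
    then show ?thesis using that by auto
  qed
  have ej: "edge_jump n s x y z = - (on x y * dist x y)"
    if "\<not> collinear {x, y, z}" "n \<bullet> z \<le> s" for x y z
  proof (cases "n \<bullet> x = s \<and> n \<bullet> y = s")
    case True
    have "n \<noteq> 0" using n'(1) by auto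
    then have "n \<bullet> z \<noteq> s" using collinear_if_same_level[of n x y z] that True by auto
    then show ?thesis using True that by (simp add: edge_jump_def on_def)
  qed (auto simp: edge_jump_def on_def)
  have "- dist B C = triangle_jump n s A B C"
    using n' by (simp add: triangle_jump_def edge_jump_def)
  also have "\<dots> = (\<Sum>t\<in>F. - (on (q t) (r t) * a + on (r t) (p t) * b + on (p t) (q t) * c))"
    unfolding triangle_jump_sum[OF n'(1)]
  proof (rule sum.cong[OF refl])
    fix t assume t: "t \<in> F"
    note nc = tile_nondegenerate[OF t]
    have "n \<bullet> p t \<le> s" "n \<bullet> q t \<le> s" "n \<bullet> r t \<le> s"
      using tile_vertex_in[OF t] below by auto
    moreover have "\<not> collinear {q t, r t, p t}" "\<not> collinear {r t, p t, q t}"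
      using nc by (auto simp: insert_commute)
    ultimately show "triangle_jump n s (p t) (q t) (r t) =
      - (on (q t) (r t) * a + on (r t) (p t) * b + on (p t) (q t) * c)"
      using nc len[OF t] unfolding triangle_jump_def by (simp add: ej)
  qed
  finally have "dist B C = (\<Sum>t\<in>F. on (q t) (r t)) * a + (\<Sum>t\<in>F. on (r t) (p t)) * b
      + (\<Sum>t\<in>F. on (p t) (q t)) * c"
    by (simp only: sum_negf neg_equal_iff_equal) (simp add: sum.distrib sum_distrib_right)
  then show ?thesis by blast
qed

end

subsection \<open>Directions of the edges of a triangle\<close>

definition dir :: "real \<Rightarrow> real^2" where
  "dir \<theta> = vector [cos \<theta>, sin \<theta>]"

lemma dir_nth [simp]: "dir \<theta> $ 1 = cos \<theta>" "dir \<theta> $ 2 = sin \<theta>"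
  by (simp_all add: dir_def)

lemma inner_dir [simp]: "dir \<theta> \<bullet> dir \<phi> = cos (\<theta> - \<phi>)"
  by (simp add: inner_vec_def sum_2 cos_diff)

lemma norm_dir [simp]: "norm (dir \<theta>) = 1"
  by (simp add: norm_eq_1)

lemma dir_nonzero: "dir \<theta> \<noteq> 0"
proof
  assume "dir \<theta> = 0"
  then have "norm (dir \<theta>) = 0" by (simp only: norm_zero)
  then show False by simp
qed

lemma dir_plus_pi: "dir (\<theta> + pi) = - dir \<theta>"
  by (simp add: vec_eq_iff forall_2)

lemma dir_add: "dir (\<theta> + \<phi>) = cos \<phi> *\<^sub>R dir \<theta> + sin \<phi> *\<^sub>R dir (\<theta> + pi / 2)"
  by (simp add: vec_eq_iff forall_2 cos_add sin_add)

lemma dir_eq_iff: "dir x = dir y \<longleftrightarrow> (\<exists>n::int. x = y + 2 * pi * n)"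
  unfolding vec_eq_iff forall_2 dir_nth by (subst conj_commute) (rule sin_cos_eq_iff)

lemma dir_add_cong: "dir x = dir y \<Longrightarrow> dir (x + z) = dir (y + z)"
  by (auto simp: dir_eq_iff)

lemma unit_vector_dir:
  fixes u :: "real^2"
  assumes "norm u = 1"
  obtains \<theta> where "u = dir \<theta>"
proof -
  have "(u $ 1)\<^sup>2 + (u $ 2)\<^sup>2 = 1"
    using assms by (simp add: norm_eq_1 inner_vec_def sum_2 power2_eq_square)
  then obtain \<theta> where "u $ 1 = cos \<theta>" "u $ 2 = sin \<theta>" using sincos_total_2pi by blast
  then show ?thesis by (intro that[of \<theta>]) (simp add: vec_eq_iff forall_2)
qed

lemma decompose_dir:
  fixes v :: "real^2"
  shows "v = (dir \<theta> \<bullet> v) *\<^sub>R dir \<theta> + (dir (\<theta> + pi / 2) \<bullet> v) *\<^sub>R dir (\<theta> + pi / 2)"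
proof -
  define c s where "c = cos \<theta>" and "s = sin \<theta>"
  have "c * c + s * s = 1" unfolding c_def s_def by (rule sin_cos_squared_add3)
  then have "v$1 = (c * v$1 + s * v$2) * c - (c * v$2 - s * v$1) * s"
    "v$2 = (c * v$1 + s * v$2) * s + (c * v$2 - s * v$1) * c" by algebra+
  then show ?thesis
    unfolding vec_eq_iff forall_2 by (simp add: inner_vec_def sum_2 cos_add sin_add c_def s_def)
qed

text \<open>Cauchy-Schwarz puts the quotient in the range where \<open>arccos\<close> inverts
  \<open>cos\<close>. In this multiplied form the identity also covers zero vectors.\<close>

lemma cos_angle:
  "norm (a - b) * norm (c - b) * cos (angle a b c) = (a - b) \<bullet> (c - b)"
proof (cases "a = b \<or> c = b")
  case False
  define w where "w = ((a - b) \<bullet> (c - b)) / (norm (a - b) * norm (c - b))"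
  have "\<bar>(a - b) \<bullet> (c - b)\<bar> \<le> norm (a - b) * norm (c - b)" by (rule Cauchy_Schwarz_ineq2)
  then have "\<bar>w\<bar> \<le> 1" using False by (simp add: w_def)
  then have "cos (arccos w) = w" by (intro cos_arccos) auto
  then show ?thesis using False by (simp add: angle_def w_def)
qed auto

lemma angle_commute: "angle a b c = angle c b a"
  by (simp add: angle_def inner_commute mult.commute)

lemma sin_angle_nonneg: "sin (angle a b c) \<ge> 0"
proof -
  define w where "w = ((a - b) \<bullet> (c - b)) / (norm (a - b) * norm (c - b))"
  have "\<bar>(a - b) \<bullet> (c - b)\<bar> \<le> norm (a - b) * norm (c - b)" by (rule Cauchy_Schwarz_ineq2)
  then have "\<bar>w\<bar> \<le> 1" by (cases "a = b \<or> c = b") (auto simp: w_def)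
  then show ?thesis
    unfolding angle_def w_def[symmetric] by (intro sin_ge_zero arccos_lbound arccos_ubound) auto
qed

text \<open>Here \<open>\<sigma>\<close> is the orientation of the triangle, so it is the same for all three edges.\<close>
definition outward :: "real \<Rightarrow> real \<Rightarrow> real^2 \<Rightarrow> real^2 \<Rightarrow> real^2 \<Rightarrow> bool" where
  "outward \<sigma> \<theta> q r p \<longleftrightarrow> r - q = (\<sigma> * dist q r) *\<^sub>R dir (\<theta> + pi / 2) \<and> dir \<theta> \<bullet> p < dir \<theta> \<bullet> r"

lemma outward_inner_eq: "outward \<sigma> \<theta> q r p \<Longrightarrow> dir \<theta> \<bullet> q = dir \<theta> \<bullet> r"
proof -
  assume "outward \<sigma> \<theta> q r p"
  then have "dir \<theta> \<bullet> (r - q) = 0" by (simp add: outward_def)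
  then show ?thesis by (simp add: inner_diff_right)
qed

lemma outward_outer_normal: "outward \<sigma> \<theta> q r p \<Longrightarrow> outer_normal (dir \<theta>) q r p"
  using outward_inner_eq[of \<sigma> \<theta> q r p] by (simp add: outer_normal_def outward_def)

text \<open>Walking round the boundary past the vertex \<open>r\<close>, the outer normal turns by
  the exterior angle \<open>pi - angle p r q\<close> in the sense given by
  \<open>\<sigma>\<close>.\<close>

lemma outward_next:
  assumes out: "outward \<sigma> \<theta> q r p" and \<sigma>: "\<sigma> = 1 \<or> \<sigma> = -1" and "q \<noteq> r"
  shows "outward \<sigma> (\<theta> + \<sigma> * (pi - angle p r q)) r p q"
proof -
  define \<gamma> n m a b where "\<gamma> = angle p r q" and "n = dir \<theta>" and "m = dir (\<theta> + pi / 2)"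
    and "a = norm (q - r)" and "b = norm (p - r)"
  \<comment> \<open>Coordinates of the next edge along the normal and along the current edge;
    \<open>X < 0\<close> because \<open>p\<close> lies on the inner side.\<close>
  define X Y where "X = n \<bullet> (p - r)" and "Y = m \<bullet> (p - r)"
  have nm: "n \<bullet> n = 1" "m \<bullet> m = 1" "n \<bullet> m = 0" "m \<bullet> n = 0"
    by (simp_all add: n_def m_def)
  have pr: "p - r = X *\<^sub>R n + Y *\<^sub>R m"
    using decompose_dir[of "p - r" \<theta>] by (simp add: X_def Y_def n_def m_def)
  have "X < 0" using out by (simp add: X_def outward_def inner_diff_right n_def)
  have "q - r = - (r - q)" by simp
  also have "r - q = (\<sigma> * a) *\<^sub>R m" using out by (simp add: outward_def a_def m_def dist_norm)
  finally have qr: "q - r = - (\<sigma> * a) *\<^sub>R m" by simp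
  have \<sigma>2: "\<sigma> * \<sigma> = 1" using \<sigma> by auto
  have a: "a > 0" using \<open>q \<noteq> r\<close> by (simp add: a_def)
  have b2: "b\<^sup>2 = X\<^sup>2 + Y\<^sup>2"
    unfolding b_def power2_norm_eq_inner pr
    using nm by (simp add: inner_add_left inner_add_right power2_eq_square)
  have "X\<^sup>2 > 0" using \<open>X < 0\<close> by simp
  then have "b\<^sup>2 > 0" unfolding b2 by (rule add_pos_nonneg) simp
  moreover have b0: "b \<ge> 0" by (simp add: b_def)
  ultimately have b: "b > 0" by (simp add: less_le)
  have "a * (b * cos \<gamma>) = a * (- \<sigma> * Y)"
    using cos_angle[of p r q] nm
    by (simp add: mult_ac \<gamma>_def[symmetric] a_def[symmetric] b_def[symmetric])
      (simp add: pr qr inner_add_left mult_ac)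
  then have c: "b * cos \<gamma> = - \<sigma> * Y" using a by (subst (asm) mult_left_cancel) auto
  have "(b * sin \<gamma>)\<^sup>2 = b\<^sup>2 - (b * cos \<gamma>)\<^sup>2"
    by (simp add: power_mult_distrib sin_squared_eq algebra_simps)
  also have "\<dots> = (- X)\<^sup>2" unfolding c b2 using \<sigma> by auto
  finally have "(b * sin \<gamma>)\<^sup>2 = (- X)\<^sup>2" .
  moreover have "0 \<le> b * sin \<gamma>"
    unfolding \<gamma>_def using b0 sin_angle_nonneg by (rule mult_nonneg_nonneg)
  \<comment> \<open>The cosine fixes the sine up to sign; both \<open>b * sin \<gamma>\<close> and
    \<open>- X\<close> are nonnegative.\<close>
  ultimately have s: "b * sin \<gamma> = - X"
    using \<open>X < 0\<close> by (simp only: power2_eq_iff_nonneg neg_0_le_iff_le less_imp_le)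
  have trig: "cos (\<sigma> * (pi - \<gamma>)) = - cos \<gamma>" "sin (\<sigma> * (pi - \<gamma>)) = \<sigma> * sin \<gamma>"
    using \<sigma> by auto
  have d1: "dir (\<theta> + \<sigma> * (pi - \<gamma>)) = (- cos \<gamma>) *\<^sub>R n + (\<sigma> * sin \<gamma>) *\<^sub>R m"
    using dir_add[of \<theta> "\<sigma> * (pi - \<gamma>)"] by (simp only: trig n_def m_def)
  have "dir (\<theta> + pi / 2 + \<sigma> * (pi - \<gamma>)) = (- cos \<gamma>) *\<^sub>R m + (\<sigma> * sin \<gamma>) *\<^sub>R dir (\<theta> + pi / 2 + pi / 2)"
    using dir_add[of "\<theta> + pi / 2" "\<sigma> * (pi - \<gamma>)"] by (simp only: trig m_def)
  moreover have "dir (\<theta> + pi / 2 + pi / 2) = - n"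
    using dir_plus_pi[of \<theta>] by (simp add: n_def add.assoc)
  ultimately have d2: "dir (\<theta> + \<sigma> * (pi - \<gamma>) + pi / 2) = (- cos \<gamma>) *\<^sub>R m - (\<sigma> * sin \<gamma>) *\<^sub>R n"
    by (simp add: add_ac)
  have "(\<sigma> * b) *\<^sub>R dir (\<theta> + \<sigma> * (pi - \<gamma>) + pi / 2) = (- \<sigma> * (b * cos \<gamma>)) *\<^sub>R m - (\<sigma> * \<sigma> * (b * sin \<gamma>)) *\<^sub>R n"
    unfolding d2 by (simp add: scaleR_diff_right mult_ac)
  also have "\<dots> = p - r"
    unfolding c s pr using \<sigma> by auto
  finally have 1: "p - r = (\<sigma> * dist r p) *\<^sub>R dir (\<theta> + \<sigma> * (pi - \<gamma>) + pi / 2)"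
    by (simp add: b_def dist_norm norm_minus_commute)
  have "dir (\<theta> + \<sigma> * (pi - \<gamma>)) \<bullet> (q - r) = - (\<sigma> * \<sigma>) * a * sin \<gamma>"
    unfolding d1 qr using nm by (simp add: inner_add_left inner_diff_left)
  moreover have "b * sin \<gamma> > 0" using s \<open>X < 0\<close> by simp
  from mult_pos_pos[OF a zero_less_mult_pos[OF this b]] have "a * sin \<gamma> > 0" .
  ultimately have "dir (\<theta> + \<sigma> * (pi - \<gamma>)) \<bullet> (q - r) < 0" using \<sigma>2 by simp
  then have 2: "dir (\<theta> + \<sigma> * (pi - \<gamma>)) \<bullet> q < dir (\<theta> + \<sigma> * (pi - \<gamma>)) \<bullet> r"
    by (simp add: inner_diff_right)
  have "dir (\<theta> + \<sigma> * (pi - \<gamma>)) \<bullet> (p - r) = 0" unfolding 1 by simp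
  then have "dir (\<theta> + \<sigma> * (pi - \<gamma>)) \<bullet> p = dir (\<theta> + \<sigma> * (pi - \<gamma>)) \<bullet> r"
    by (simp add: inner_diff_right)
  with 1 2 show ?thesis
    unfolding outward_def \<gamma>_def[symmetric] by (simp only: simp_thms)
qed

text \<open>The edge has two unit normals. Choosing the one that points away from \<open>p\<close>
  determines the orientation \<open>\<sigma>\<close>.\<close>

lemma outward_exists:
  assumes nc: "\<not> collinear {p, q, r}"
  obtains \<sigma> \<theta> where "\<sigma> = 1 \<or> \<sigma> = -1" "outward \<sigma> \<theta> q r p"
proof -
  have "q \<noteq> r" using nc by auto
  then have "norm ((r - q) /\<^sub>R dist q r) = 1" by (simp add: dist_norm norm_minus_commute)
  then obtain \<phi> where "(r - q) /\<^sub>R dist q r = dir \<phi>" by (rule unit_vector_dir)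
  moreover have "r - q = dist q r *\<^sub>R ((r - q) /\<^sub>R dist q r)" using \<open>q \<noteq> r\<close> by simp
  ultimately have \<phi>: "r - q = dist q r *\<^sub>R dir \<phi>" by simp
  have eq: "dir (\<phi> - pi / 2) \<bullet> q = dir (\<phi> - pi / 2) \<bullet> r"
  proof -
    have "dir (\<phi> - pi / 2) \<bullet> (r - q) = 0" unfolding \<phi> by simp
    then show ?thesis by (simp add: inner_diff_right)
  qed
  have neg: "dir (\<phi> + pi / 2) = - dir (\<phi> - pi / 2)"
    using dir_plus_pi[of "\<phi> - pi / 2"] by (simp add: algebra_simps)
  have "dir (\<phi> - pi / 2) \<bullet> p \<noteq> dir (\<phi> - pi / 2) \<bullet> r"
  proof
    assume "dir (\<phi> - pi / 2) \<bullet> p = dir (\<phi> - pi / 2) \<bullet> r"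
    from collinear_if_same_level[OF dir_nonzero this eq] nc show False
      by (simp add: insert_commute)
  qed
  then consider "dir (\<phi> - pi / 2) \<bullet> p < dir (\<phi> - pi / 2) \<bullet> r" | "dir (\<phi> - pi / 2) \<bullet> p > dir (\<phi> - pi / 2) \<bullet> r"
    by linarith
  then show ?thesis
  proof cases
    case 1
    then show ?thesis using \<phi> by (intro that[of 1 "\<phi> - pi / 2"]) (simp_all add: outward_def)
  next
    case 2
    have "dir (\<phi> + pi / 2 + pi / 2) = - dir \<phi>" using dir_plus_pi[of \<phi>] by (simp add: add.assoc)
    then show ?thesis using \<phi> 2 neg by (intro that[of "-1" "\<phi> + pi / 2"]) (simp_all add: outward_def)
  qed
qed

text \<open>Start at the edge \<open>q r\<close> and turn at \<open>r\<close>, then at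
  \<open>p\<close>; only these two angles enter.\<close>

lemma triangle_normals_exist:
  assumes nc: "\<not> collinear {p, q, r}"
  obtains \<sigma> \<theta> where "\<sigma> = 1 \<or> \<sigma> = -1"
    "triangle_normals p q r (dir \<theta>) (dir (\<theta> + \<sigma> * (pi - angle p r q)))
      (dir (\<theta> + \<sigma> * (pi - angle p r q) + \<sigma> * (pi - angle q p r)))"
proof -
  obtain \<sigma> \<theta> where \<sigma>: "\<sigma> = 1 \<or> \<sigma> = -1" and 1: "outward \<sigma> \<theta> q r p"
    using outward_exists[OF nc] .
  have ne: "q \<noteq> r" "r \<noteq> p" using nc by (auto simp: insert_commute)
  note 2 = outward_next[OF 1 \<sigma> ne(1)]
  note 3 = outward_next[OF 2 \<sigma> ne(2)]
  from 1 2 3 show ?thesis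
    by (intro that[OF \<sigma>, of \<theta>]) (simp only: triangle_normals_def outward_outer_normal)
qed

text \<open>Lagrange's identity for the two edge vectors at \<open>r\<close>.\<close>

lemma area_triangle_squared:
  fixes p q r :: "real^2"
  shows "(2 * measure lebesgue (convex hull {p, q, r}))\<^sup>2 =
    (dist q r)\<^sup>2 * (dist r p)\<^sup>2 - ((q - r) \<bullet> (p - r))\<^sup>2"
proof -
  define u v where "u = q - r" and "v = p - r"
  have "2 * measure lebesgue (convex hull {p, q, r}) = 2 * measure lebesgue (convex hull {r, q, p})"
    by (simp add: insert_commute)
  also have "\<dots> = \<bar>v$1 * u$2 - u$1 * v$2\<bar>"
    by (simp add: lebesgue_measure_triangle u_def v_def)
  finally have "(2 * measure lebesgue (convex hull {p, q, r}))\<^sup>2 = (v$1 * u$2 - u$1 * v$2)\<^sup>2" by simp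
  also have "\<dots> = (u \<bullet> u) * (v \<bullet> v) - (u \<bullet> v)\<^sup>2"
    by (simp add: inner_vec_def sum_2 power2_eq_square algebra_simps)
  finally show ?thesis
    by (simp add: u_def v_def dist_norm norm_minus_commute[of r p] power2_norm_eq_inner)
qed

subsection \<open>Sign characters of directions\<close>

text \<open>\<open>dirs \<theta> \<alpha> e m\<close> is the part of parity \<open>m\<close> of the orbit of \<open>dir \<theta>\<close> under the rotations
  through multiples of \<open>\<pi> / 3\<close> and \<open>\<alpha>\<close>. The two parities are disjoint only because \<open>\<alpha> / \<pi>\<close> is
  irrational.\<close>
definition dirs :: "real \<Rightarrow> real \<Rightarrow> int \<Rightarrow> int \<Rightarrow> (real^2) set" where
  "dirs \<theta> \<alpha> e m = {dir (\<theta> + real_of_int j * (pi / 3) + real_of_int k * \<alpha>) | j k. even (j + e * k + m)}"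

text \<open>The sign character, extended by 0 off the orbit. A rotation by \<open>pi / 3\<close>
  flips its sign, and a rotation by \<open>\<alpha>\<close> flips it exactly when \<open>e\<close>
  is odd.\<close>

definition chi :: "real \<Rightarrow> real \<Rightarrow> int \<Rightarrow> real^2 \<Rightarrow> int" where
  "chi \<theta> \<alpha> e d = of_bool (d \<in> dirs \<theta> \<alpha> e 0) - of_bool (d \<in> dirs \<theta> \<alpha> e 1)"

lemma dirs_cong: "even (m - m') \<Longrightarrow> dirs \<theta> \<alpha> e m = dirs \<theta> \<alpha> e m'"
proof -
  assume "even (m - m')"
  then have "even (j + e * k + m) = even (j + e * k + m')" for j k by presburger
  then show ?thesis by (simp add: dirs_def)
qed

lemma dirs_shift_imp:
  fixes j k :: int and \<alpha> :: real
  assumes "dir \<phi> \<in> dirs \<theta> \<alpha> e m"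
  shows "dir (\<phi> + j * (pi / 3) + k * \<alpha>) \<in> dirs \<theta> \<alpha> e (m + j + e * k)"
proof -
  obtain j' k' :: int where "dir \<phi> = dir (\<theta> + j' * (pi / 3) + k' * \<alpha>)" and ev: "even (j' + e * k' + m)"
    using assms unfolding dirs_def by blast
  then have "dir (\<phi> + (j * (pi / 3) + k * \<alpha>)) = dir (\<theta> + j' * (pi / 3) + k' * \<alpha> + (j * (pi / 3) + k * \<alpha>))"
    by (intro dir_add_cong)
  also have "\<theta> + j' * (pi / 3) + k' * \<alpha> + (j * (pi / 3) + k * \<alpha>) =
      \<theta> + (j' + j :: int) * (pi / 3) + (k' + k :: int) * \<alpha>"
    by (simp add: algebra_simps)
  finally have "dir (\<phi> + j * (pi / 3) + k * \<alpha>) = dir (\<theta> + (j' + j :: int) * (pi / 3) + (k' + k :: int) * \<alpha>)"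
    by (simp add: add.assoc)
  moreover have "even ((j' + j) + e * (k' + k) + (m + j + e * k))"
  proof -
    have "(j' + j) + e * (k' + k) + (m + j + e * k) = (j' + e * k' + m) + 2 * (j + e * k)"
      by (simp add: algebra_simps)
    then show ?thesis by (simp only: dvd_add[OF ev dvd_triv_left])
  qed
  ultimately show ?thesis unfolding dirs_def by blast
qed

lemma dirs_shift:
  fixes j k :: int and \<alpha> :: real
  shows "dir (\<phi> + j * (pi / 3) + k * \<alpha>) \<in> dirs \<theta> \<alpha> e (m + j + e * k) \<longleftrightarrow> dir \<phi> \<in> dirs \<theta> \<alpha> e m"
proof
  assume "dir (\<phi> + j * (pi / 3) + k * \<alpha>) \<in> dirs \<theta> \<alpha> e (m + j + e * k)"
  from dirs_shift_imp[OF this, of "- j" "- k"] show "dir \<phi> \<in> dirs \<theta> \<alpha> e m" by simp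
qed (rule dirs_shift_imp)

lemma chi_shift:
  fixes j k :: int and \<alpha> :: real
  shows "chi \<theta> \<alpha> e (dir (\<phi> + j * (pi / 3) + k * \<alpha>)) =
    (if even (j + e * k) then 1 else -1) * chi \<theta> \<alpha> e (dir \<phi>)"
proof -
  note s = dirs_shift[of \<phi> j k \<alpha> \<theta> e 0] dirs_shift[of \<phi> j k \<alpha> \<theta> e 1]
  show ?thesis
  proof (cases "even (j + e * k)")
    case True
    have "dirs \<theta> \<alpha> e (0 + j + e * k) = dirs \<theta> \<alpha> e 0" "dirs \<theta> \<alpha> e (1 + j + e * k) = dirs \<theta> \<alpha> e 1"
      by (rule dirs_cong, use True in simp)+
    then show ?thesis using s by (simp only: chi_def True if_True mult_1)
  next
    case False
    have "dirs \<theta> \<alpha> e (0 + j + e * k) = dirs \<theta> \<alpha> e 1" "dirs \<theta> \<alpha> e (1 + j + e * k) = dirs \<theta> \<alpha> e 0"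
      by (rule dirs_cong, use False in simp)+
    then show ?thesis using s by (simp only: chi_def False if_False) simp
  qed
qed

text \<open>Negation is a rotation by three steps of \<open>pi / 3\<close>, an odd number. For
  vectors that are not of unit length both sides are 0.\<close>

lemma chi_uminus: "chi \<theta> \<alpha> e (- d) = - chi \<theta> \<alpha> e d"
proof (cases "\<exists>\<phi>. d = dir \<phi>")
  case True
  then obtain \<phi> where \<phi>: "d = dir \<phi>" by blast
  have "chi \<theta> \<alpha> e (dir (\<phi> + pi)) = - chi \<theta> \<alpha> e (dir \<phi>)"
    using chi_shift[of \<theta> \<alpha> e \<phi> 3 0] by simp
  then show ?thesis by (simp add: \<phi> dir_plus_pi)
next
  case False
  then have "norm d \<noteq> 1" using unit_vector_dir by metis
  then have "d \<notin> dirs \<theta> \<alpha> e m" "- d \<notin> dirs \<theta> \<alpha> e m" for m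
    using norm_dir by (auto simp: dirs_def) (metis norm_dir norm_minus_cancel)+
  then show ?thesis by (simp add: chi_def)
qed

lemma abs_chi_le: "\<bar>chi \<theta> \<alpha> e d\<bar> \<le> 1"
  by (simp add: chi_def)

text \<open>Were \<open>dir \<theta>\<close> in both parts, some
  \<open>j * (pi / 3) + k * \<alpha>\<close> would be a multiple of \<open>2 * pi\<close>.
  Irrationality gives \<open>k = 0\<close>; then \<open>j\<close> is a multiple of 6, against the
  odd parity.\<close>

lemma chi_base:
  assumes "\<not> (\<exists>r\<in>\<rat>. \<alpha> = r * pi)"
  shows "chi \<theta> \<alpha> e (dir \<theta>) = 1"
proof -
  have "dir \<theta> \<in> dirs \<theta> \<alpha> e 0"
    unfolding dirs_def by (rule CollectI, rule exI[of _ 0], rule exI[of _ 0]) simp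
  moreover have "dir \<theta> \<notin> dirs \<theta> \<alpha> e 1"
  proof
    assume "dir \<theta> \<in> dirs \<theta> \<alpha> e 1"
    then obtain j k :: int where "dir \<theta> = dir (\<theta> + j * (pi / 3) + k * \<alpha>)" and ev: "even (j + e * k + 1)"
      unfolding dirs_def by blast
    then obtain n :: int where n: "\<theta> = \<theta> + j * (pi / 3) + k * \<alpha> + 2 * pi * n"
      unfolding dir_eq_iff by blast
    have "k = 0"
    proof (rule ccontr)
      assume "k \<noteq> 0"
      then have "\<alpha> = ((- 2 * n - j / 3) / k) * pi" using n by (simp add: field_simps)
      moreover have "(- 2 * n - j / 3) / k \<in> \<rat>" by simp
      ultimately show False using assms by blast
    qed
    then have "pi * j = pi * (- 6 * n)" using n by (simp add: algebra_simps)
    then have "real_of_int j = real_of_int (- 6 * n)" by (subst (asm) mult_left_cancel) auto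
    then have "j = - 6 * n" by linarith
    then show False using ev \<open>k = 0\<close> by simp
  qed
  ultimately show ?thesis by (simp add: chi_def)
qed

subsection \<open>Arithmetic\<close>

lemma rational_square_root_imp_int:
  fixes w :: real and k :: nat and i m :: int
  assumes "w\<^sup>2 = m" "k > 0" "k * w = i"
  shows "\<exists>j::int. w = j"
proof -
  have "real_of_int (i\<^sup>2) = real_of_int ((int k)\<^sup>2 * m)"
    using assms(1) unfolding of_int_power of_int_mult assms(3)[symmetric]
    by (simp add: power_mult_distrib)
  then have "i\<^sup>2 = (int k)\<^sup>2 * m" by (simp only: of_int_eq_iff)
  then have "(int k)\<^sup>2 dvd i\<^sup>2" by simp
  then have "int k dvd i" by (simp add: pow_divides_pow_iff)
  then obtain j where "i = int k * j" by blast
  then have "k * w = k * real_of_int j" using assms(3) by simp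
  then have "w = j" using assms(2) by simp
  then show ?thesis by blast
qed

text \<open>The product is \<open>(N + 5)\<^sup>2 - 16\<close>, which for \<open>N > 3\<close> lies
  strictly between \<open>(N + 4)\<^sup>2\<close> and \<open>(N + 5)\<^sup>2\<close>.\<close>

lemma product_not_square:
  fixes N :: nat and w :: int
  assumes "N > 3" "w\<^sup>2 = (int N + 1) * (int N + 9)" 
  shows False
proof -
  have "\<bar>w\<bar>\<^sup>2 < (int N + 5)\<^sup>2" using assms by (simp add: power2_eq_square algebra_simps)
  then have "\<bar>w\<bar> < int N + 5" by (rule power2_less_imp_less) simp
  then have "\<bar>w\<bar>\<^sup>2 \<le> (int N + 4)\<^sup>2" by (intro power_mono) auto
  then have "(int N + 1) * (int N + 9) \<le> (int N + 4)\<^sup>2" using assms by simp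
  then show False using assms(1) by (simp add: power2_eq_square algebra_simps)
qed

text \<open>In units of \<open>t\<close>, both \<open>c\<close> and \<open>b - a\<close> are
  rational, while \<open>a + b\<close> is \<open>w / 2\<close> with \<open>w\<close> irrational. In
  the decomposition \<open>w\<close> has coefficient \<open>x + y\<close>, so this must vanish,
  leaving a multiple of \<open>c\<close> alone.\<close>

lemma side_not_decomposable:
  fixes a b c t :: real and N x y z :: nat
  assumes t: "t > 0" and "N > 3" and "a > 0" "b > 0"
    and E: "c + a - b = 3 * t" and F: "c - a + b = N * t" and ab: "a * b = N * t\<^sup>2"
    and S: "N * t = x * a + y * b + z * c"
  shows False
proof -
  define w where "w = 2 * (a + b) / t"
  have c: "2 * c = (real N + 3) * t" and d: "2 * (b - a) = (real N - 3) * t"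
    using E F by (auto simp: algebra_simps)
  have "(2 * (a + b))\<^sup>2 = (2 * (b - a))\<^sup>2 + 16 * (a * b)"
    by (simp add: power2_eq_square algebra_simps)
  also have "\<dots> = ((real N + 1) * (real N + 9)) * t\<^sup>2"
    unfolding d ab by (simp add: power2_eq_square algebra_simps)
  finally have "w\<^sup>2 = (real N + 1) * (real N + 9)"
    using t by (simp add: w_def power_divide)
  then have w2: "w\<^sup>2 = of_int ((int N + 1) * (int N + 9))" by simp
  have wt: "2 * (a + b) = w * t" using t by (simp add: w_def)
  have abc: "4 * a = (w - (real N - 3)) * t" "4 * b = (w + (real N - 3)) * t" "4 * c = 2 * (real N + 3) * t"
    using wt c d by (auto simp: algebra_simps)
  have "4 * N * t = x * (4 * a) + y * (4 * b) + z * (4 * c)" using S by simp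
  also have "\<dots> = ((x + y) * w + (real y - x) * (real N - 3) + 2 * z * (N + 3)) * t"
    unfolding abc by (simp add: algebra_simps)
  finally have main: "4 * real N = real (x + y) * w + (real y - x) * (real N - 3) + 2 * z * (N + 3)"
    using t by simp
  show False
  proof (cases "x + y = 0")
    case True
    then have "4 * real N = 2 * z * (N + 3)" using main by simp
    then have "real (2 * N) = real (z * (N + 3))" by simp
    then have zN: "2 * N = z * (N + 3)" by (simp only: of_nat_eq_iff)
    \<comment> \<open>\<open>z = 1\<close> would mean \<open>N = 3\<close>, and from
      \<open>z = 2\<close> on the right-hand side exceeds \<open>2 * N\<close>.\<close>
    have "z \<noteq> 0" "z \<noteq> 1" by (rule notI, use zN \<open>N > 3\<close> in simp)+
    then have "2 * (N + 3) \<le> z * (N + 3)" by (intro mult_right_mono) auto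
    then show False using zN by simp
  next
    case False
    have "real (x + y) * w = of_int (4 * int N - (int y - int x) * (int N - 3) - 2 * int z * (int N + 3))"
      using main by simp
    from rational_square_root_imp_int[OF w2 _ this] False obtain j :: int where "w = j" by auto
    then have "real_of_int (j\<^sup>2) = real_of_int ((int N + 1) * (int N + 9))" using w2 by simp
    then have "j\<^sup>2 = (int N + 1) * (int N + 9)" by (simp only: of_int_eq_iff)
    with product_not_square[OF \<open>N > 3\<close>] show False .
  qed
qed

lemma prime_tile_count_impossible:
  fixes a b c S :: real and N x y z :: nat and n m :: int
  assumes pos: "a > 0" "b > 0" "c > 0" "S > 0" and "a \<noteq> b"
    and cos_law: "c\<^sup>2 = a\<^sup>2 + b\<^sup>2 + a * b"
    and area: "S\<^sup>2 = N * (a * b)"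
    and n: "n * (c + a - b) = 3 * S" "\<bar>n\<bar> \<le> int N"
    and m: "m * (c - a + b) = 3 * S" "\<bar>m\<bar> \<le> int N"
    and S: "S = x * a + y * b + z * c"
    and "prime N"
  shows False
proof -
  define E F where "E = c + a - b" and "F = c - a + b"
  have EF: "E * F = 3 * (a * b)"
    using cos_law by (simp add: E_def F_def power2_eq_square algebra_simps)
  have "0 < a * b" using pos by simp
  then have "\<bar>a - b\<bar>\<^sup>2 < c\<^sup>2" using cos_law by (simp add: power2_eq_square algebra_simps)
  then have "\<bar>a - b\<bar> < c" by (rule power2_less_imp_less) (use pos in simp)
  then have pos': "E > 0" "F > 0" by (auto simp: E_def F_def)
  have nE: "n * E = 3 * S" and mF: "m * F = 3 * S" using n m by (auto simp: E_def F_def)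
  have "real_of_int n * E > 0" "real_of_int m * F > 0" using nE mF pos by auto
  then have "n > 0" "m > 0" using pos' by (auto simp: zero_less_mult_iff)
  have "(n * m) * (E * F) = (n * E) * (m * F)" by simp
  also have "\<dots> = 9 * S\<^sup>2" unfolding nE mF by (simp add: power2_eq_square)
  also have "\<dots> = (3 * N) * (E * F)" unfolding area EF by simp
  finally have "real_of_int (n * m) = real_of_int (3 * int N)" using pos' by simp
  then have nm: "n * m = 3 * int N" by (simp only: of_int_eq_iff)
  have "prime (int N)" using \<open>prime N\<close> by simp
  moreover have "int N dvd n * m" using nm by simp
  ultimately have "int N dvd n \<or> int N dvd m" by (rule prime_dvd_multD)
  then have "n = int N \<or> m = int N"
    using zdvd_imp_le[of "int N" n] zdvd_imp_le[of "int N" m] \<open>n > 0\<close> \<open>m > 0\<close> n m by auto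
  moreover have "N > 0" using \<open>prime N\<close> by (simp add: prime_gt_0_nat)
  ultimately have cases: "n = int N \<and> m = 3 \<or> n = 3 \<and> m = int N" using nm by auto
  \<comment> \<open>One of \<open>n\<close>, \<open>m\<close> is 3, and both are bounded by
    \<open>N\<close>. Equality would give \<open>n = m\<close>, hence \<open>E = F\<close>, which
    means \<open>a = b\<close>.\<close>
  then have "N \<ge> 3" using n m by auto
  moreover have "N \<noteq> 3"
  proof
    assume "N = 3"
    then have "E = F" using cases nE mF by auto
    then show False using \<open>a \<noteq> b\<close> by (simp add: E_def F_def)
  qed
  ultimately have N: "N > 3" by simp
  from cases show False
  proof
    assume *: "n = int N \<and> m = 3"
    define t where "t = E / 3"
    have t: "E = 3 * t" "F = N * t" "t > 0" "S = N * t" using * nE mF pos' by (auto simp: t_def)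
    have "a * b = N * t\<^sup>2" using EF by (simp add: t power2_eq_square mult_ac)
    with N pos t S show False
      by (intro side_not_decomposable[of t N a b c x y z]) (auto simp: E_def F_def)
  next
    \<comment> \<open>The mirror image of the first case, with \<open>a\<close> and \<open>b\<close>
      exchanged.\<close>
    assume *: "n = 3 \<and> m = int N"
    define t where "t = F / 3"
    have t: "F = 3 * t" "E = N * t" "t > 0" "S = N * t" using * nE mF pos' by (auto simp: t_def)
    have "b * a = N * t\<^sup>2" using EF by (simp add: t power2_eq_square mult_ac)
    with N pos t S show False
      by (intro side_not_decomposable[of t N b a c y x z]) (auto simp: E_def F_def)
  qed
qed

subsection \<open>Congruent tiles\<close>

lemma inner_eq_dist:
  fixes a b c :: "real^2"
  shows "(a - b) \<bullet> (c - b) = ((dist a b)\<^sup>2 + (dist c b)\<^sup>2 - (dist a c)\<^sup>2) / 2"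
  by (simp add: dist_norm power2_norm_eq_inner inner_diff_left inner_diff_right inner_commute)

text \<open>Angles depend on side lengths alone, so congruent tiles inherit them, also when turned
  over.\<close>

lemma angle_eq_dist:
  "angle a b c = arccos (((dist a b)\<^sup>2 + (dist c b)\<^sup>2 - (dist a c)\<^sup>2) / 2 / (dist a b * dist c b))"
  unfolding angle_def inner_eq_dist by (simp add: dist_norm)

text \<open>An isometry is a translation after an orthogonal linear map, so it carries the hull of
  the vertices to the hull of their images.\<close>

lemma congruent_triangle:
  assumes "congruent_sets t (convex hull {P, Q, R})"
  obtains p q r where "t = convex hull {p, q, r}"
    "dist q r = dist Q R" "dist r p = dist R P" "dist p q = dist P Q"
proof -
  obtain f :: "real^2 \<Rightarrow> real^2" where iso: "\<And>x y. dist (f x) (f y) = dist x y"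
    and t: "f ` (convex hull {P, Q, R}) = t"
    using assms unfolding congruent_sets_def by blast
  define L where "L x = f x - f 0" for x
  have "orthogonal_transformation L"
    unfolding orthogonal_transformation_isometry L_def using iso by (simp add: dist_norm)
  then have "linear L" by (rule orthogonal_transformation_linear)
  have f: "f = (\<lambda>x. f 0 + x) \<circ> L" by (auto simp: L_def)
  have "t = (\<lambda>x. f 0 + x) ` L ` (convex hull {P, Q, R})"
    unfolding t[symmetric] image_comp f[symmetric] ..
  also have "\<dots> = convex hull ((\<lambda>x. f 0 + x) ` L ` {P, Q, R})"
    by (simp only: convex_hull_linear_image[OF \<open>linear L\<close>] convex_hull_translation)
  also have "(\<lambda>x. f 0 + x) ` L ` {P, Q, R} = {f P, f Q, f R}" by (simp add: L_def)
  finally show ?thesis using iso by (intro that[of "f P" "f Q" "f R"])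
qed

text \<open>In this form nondegeneracy is a condition on side lengths, which passes to every
  congruent tile.\<close>

lemma collinear_iff_dist:
  fixes a b c :: "real^2"
  shows "collinear {a, b, c} \<longleftrightarrow>
    dist b c = dist b a + dist a c \<or> dist c a = dist c b + dist b a \<or> dist a b = dist a c + dist c b"
  by (simp add: collinear_between_cases between)

lemma angle_equilateral:
  assumes "dist a b = s" "dist b c = s" "dist c a = s" "s > 0"
  shows "angle a b c = pi / 3"
proof -
  have "angle a b c = arccos (1 / 2)"
    using assms by (simp add: angle_eq_dist dist_commute power2_eq_square)
  also have "\<dots> = arccos (cos (pi / 3))" by (simp add: cos_60)
  also have "\<dots> = pi / 3" by (rule arccos_cos) auto
  finally show ?thesis .
qed

lemma area_angle:
  fixes p q r :: "real^2"
  shows "2 * measure lebesgue (convex hull {p, q, r}) = dist q r * dist r p * sin (angle p r q)"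
proof (rule power2_eq_imp_eq)
  define \<gamma> where "\<gamma> = angle p r q"
  have "(q - r) \<bullet> (p - r) = dist q r * dist r p * cos \<gamma>"
    using cos_angle[of p r q] by (simp add: \<gamma>_def inner_commute dist_norm norm_minus_commute mult_ac)
  then have "(2 * measure lebesgue (convex hull {p, q, r}))\<^sup>2 =
      (dist q r)\<^sup>2 * (dist r p)\<^sup>2 * (1 - (cos \<gamma>)\<^sup>2)"
    unfolding area_triangle_squared by (simp add: power_mult_distrib right_diff_distrib)
  also have "\<dots> = (dist q r * dist r p * sin \<gamma>)\<^sup>2"
    by (simp add: power_mult_distrib sin_squared_eq)
  finally show "(2 * measure lebesgue (convex hull {p, q, r}))\<^sup>2 = (dist q r * dist r p * sin (angle p r q))\<^sup>2"
    by (simp add: \<gamma>_def)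
qed (auto intro!: mult_nonneg_nonneg sin_angle_nonneg)

lemma sin_two_pi_thirds: "sin (2 * pi / 3) = sin (pi / 3)"
  using sin_pi_minus[of "pi / 3"] by simp

lemma cos_two_pi_thirds: "cos (2 * pi / 3) = - 1 / 2"
  using cos_pi_minus[of "pi / 3"] by (simp add: cos_60)

section \<open>Character sums over a tile and over the equilateral triangle\<close>

text \<open>The exterior angle at the obtuse vertex is \<open>pi / 3\<close>, one odd step. The
  total turn to the third normal is four steps of \<open>pi / 3\<close> less one
  \<open>\<alpha>\<close>, up to the sign \<open>s\<close>, so its parity is that of
  \<open>e\<close>.\<close>

lemma chi_sum_tile:
  fixes s e :: int and a b c :: real
  assumes "s \<in> {1, -1 :: int}"
  shows "a * chi \<theta> \<alpha> e (dir \<phi>) + b * chi \<theta> \<alpha> e (dir (\<phi> + s * (pi - 2 * pi / 3)))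
      + c * chi \<theta> \<alpha> e (dir (\<phi> + s * (pi - 2 * pi / 3) + s * (pi - \<alpha>))) =
    chi \<theta> \<alpha> e (dir \<phi>) * (a - b + (if even e then c else - c))"
proof -
  have "\<phi> + s * (pi - 2 * pi / 3) = \<phi> + s * (pi / 3) + (0 :: int) * \<alpha>" 
    by (simp add: field_simps)
  moreover have "odd (s + e * 0)" using assms by auto
  ultimately have 1: "chi \<theta> \<alpha> e (dir (\<phi> + s * (pi - 2 * pi / 3))) = - chi \<theta> \<alpha> e (dir \<phi>)"
    using chi_shift[of \<theta> \<alpha> e \<phi> s 0] by (simp only: if_False)
  have "\<phi> + s * (pi - 2 * pi / 3) + s * (pi - \<alpha>) = \<phi> + (4 * s :: int) * (pi / 3) + (- s :: int) * \<alpha>"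
    by (simp add: field_simps)
  moreover have "even (4 * s + e * - s) \<longleftrightarrow> even e" using assms by auto
  ultimately have 2: "chi \<theta> \<alpha> e (dir (\<phi> + s * (pi - 2 * pi / 3) + s * (pi - \<alpha>))) =
      (if even e then 1 else -1) * chi \<theta> \<alpha> e (dir \<phi>)"
    using chi_shift[of \<theta> \<alpha> e \<phi> "4 * s" "- s"] by (simp only:)
  show ?thesis unfolding 1 2 by (simp add: algebra_simps)
qed

text \<open>Successive normals differ by two steps of \<open>pi / 3\<close>, so all three have the
  value of the base direction.\<close>

lemma chi_sum_equilateral:
  fixes s e :: int
  assumes "\<not> (\<exists>r\<in>\<rat>. \<alpha> = r * pi)"
  shows "chi \<theta> \<alpha> e (dir \<theta>) = 1" "chi \<theta> \<alpha> e (dir (\<theta> + s * (pi - pi / 3))) = 1"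
    "chi \<theta> \<alpha> e (dir (\<theta> + s * (pi - pi / 3) + s * (pi - pi / 3))) = 1"
proof -
  show 0: "chi \<theta> \<alpha> e (dir \<theta>) = 1" using assms by (rule chi_base)
  have "\<theta> + s * (pi - pi / 3) = \<theta> + (2 * s :: int) * (pi / 3) + (0 :: int) * \<alpha>"
    by (simp add: field_simps)
  moreover have "even (2 * s + e * 0)" by simp
  ultimately show "chi \<theta> \<alpha> e (dir (\<theta> + s * (pi - pi / 3))) = 1"
    by (simp only: chi_shift if_True 0 mult_1)
  have "\<theta> + s * (pi - pi / 3) + s * (pi - pi / 3) = \<theta> + (4 * s :: int) * (pi / 3) + (0 :: int) * \<alpha>"
    by (simp add: field_simps)
  moreover have "even (4 * s + e * 0)" by simp
  ultimately show "chi \<theta> \<alpha> e (dir (\<theta> + s * (pi - pi / 3) + s * (pi - pi / 3))) = 1"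
    by (simp only: chi_shift if_True 0 mult_1)
qed

theorem theorem7:
  fixes A B C P Q R :: "real^2" and \<alpha> \<beta> \<gamma> :: real and N :: nat
  assumes "equilateral A B C"
    and "nondegenerate P Q R"
    and "angle R P Q = \<alpha>" and "angle P Q R = \<beta>" and "angle Q R P = \<gamma>"
    and "\<gamma> = 2 * pi / 3"
    and "\<not> (\<exists>r\<in>\<rat>. \<alpha> = r * pi)"
    and "tiled_by N (convex hull {A, B, C}) (convex hull {P, Q, R})"
  shows "\<not> prime N"
proof
  assume "prime N"
  define S a b c where "S = dist B C" and "a = dist Q R" and "b = dist R P" and "c = dist P Q"
  have ncABC: "\<not> collinear {A, B, C}" and ncPQR: "\<not> collinear {P, Q, R}"
    using assms(1,2) by (auto simp: equilateral_def nondegenerate_def)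
  have sides: "dist A B = S" "dist B C = S" "dist C A = S"
    using assms(1) by (auto simp: equilateral_def S_def)
  have "B \<noteq> C" "Q \<noteq> R" "R \<noteq> P" "P \<noteq> Q" using ncABC ncPQR by (auto simp: insert_commute)
  then have pos: "a > 0" "b > 0" "c > 0" "S > 0" by (auto simp: S_def a_def b_def c_def)
  have angles: "angle P R Q = 2 * pi / 3" "angle Q P R = \<alpha>"
    using assms(3,5,6) angle_commute[of P R Q] angle_commute[of Q P R] by simp_all

  obtain F where F: "finite F" "card F = N" "\<Union>F = convex hull {A, B, C}"
    "pairwise (\<lambda>s t. disjnt (interior s) (interior t)) F"
    "\<And>t. t \<in> F \<Longrightarrow> congruent_sets t (convex hull {P, Q, R})"
    using assms(8) unfolding tiled_by_def by blast
  have "\<exists>p q r. t = convex hull {p, q, r} \<and> dist q r = a \<and> dist r p = b \<and> dist p q = c"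
    if "t \<in> F" for t
    using congruent_triangle[OF F(5)[OF that]] unfolding a_def b_def c_def by metis
  then obtain p q r where pqr: "\<And>t. t \<in> F \<Longrightarrow> t = convex hull {p t, q t, r t}"
    "\<And>t. t \<in> F \<Longrightarrow> dist (q t) (r t) = a" "\<And>t. t \<in> F \<Longrightarrow> dist (r t) (p t) = b"
    "\<And>t. t \<in> F \<Longrightarrow> dist (p t) (q t) = c"
    by metis
  have nc: "\<not> collinear {p t, q t, r t}" if "t \<in> F" for t
    using ncPQR pqr(2-4)[OF that] unfolding collinear_iff_dist
    by (simp add: a_def b_def c_def dist_commute)
  interpret triangle_tiling F p q r A B C
    by unfold_locales (use F pqr nc ncABC in auto)
  have tile_angles: "angle (p t) (r t) (q t) = 2 * pi / 3" "angle (q t) (p t) (r t) = \<alpha>"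
    if "t \<in> F" for t
    using angles pqr(2-4)[OF that] unfolding angle_eq_dist
    by (simp_all add: a_def b_def c_def dist_commute)

  have "(P - R) \<bullet> (Q - R) = b * a * cos (2 * pi / 3)"
    using cos_angle[of P R Q] unfolding angles by (simp add: a_def b_def dist_norm norm_minus_commute)
  then have "(b\<^sup>2 + a\<^sup>2 - c\<^sup>2) / 2 = b * a * (- 1 / 2)"
    unfolding inner_eq_dist cos_two_pi_thirds by (simp add: a_def b_def c_def dist_commute)
  then have cos_law: "c\<^sup>2 = a\<^sup>2 + b\<^sup>2 + a * b" by (simp add: field_simps)
  \<comment> \<open>An isosceles tile would have \<open>\<alpha> = pi / 6\<close>, a rational
    multiple of \<open>pi\<close>.\<close>
  have "a \<noteq> b"
  proof
    assume "a = b"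
    then have "c\<^sup>2 = (sqrt 3 * a)\<^sup>2" using cos_law by (simp add: power2_eq_square)
    then have c: "c = sqrt 3 * a" using pos by (simp add: power2_eq_iff_nonneg)
    have "\<alpha> = arccos ((c\<^sup>2 + b\<^sup>2 - a\<^sup>2) / 2 / (c * b))"
      unfolding angles(2)[symmetric] angle_eq_dist by (simp add: a_def b_def c_def dist_commute)
    also have "\<dots> = arccos (sqrt 3 / 2)"
      using pos by (simp add: \<open>a = b\<close>[symmetric] c power2_eq_square)
    also have "\<dots> = arccos (cos (pi / 6))" by (simp add: cos_30)
    also have "\<dots> = pi / 6" by (rule arccos_cos) auto
    finally have "\<alpha> = (1 / 6) * pi" by simp
    moreover have "(1 / 6 :: real) \<in> \<rat>" by simp
    ultimately show False using assms(7) by blast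
  qed

  have ABC_angles: "angle A C B = pi / 3" "angle B A C = pi / 3"
    by (rule angle_equilateral[of _ _ S]; use sides pos in \<open>simp add: dist_commute\<close>)+
  obtain \<sigma>0 \<theta>0 where \<sigma>0: "\<sigma>0 = 1 \<or> \<sigma>0 = -1"
    and ABC: "triangle_normals A B C (dir \<theta>0) (dir (\<theta>0 + \<sigma>0 * (pi - pi / 3)))
      (dir (\<theta>0 + \<sigma>0 * (pi - pi / 3) + \<sigma>0 * (pi - pi / 3)))"
    using triangle_normals_exist[OF ncABC] unfolding ABC_angles .
  \<comment> \<open>The orientation of each tile is recast as an integer, since the shift rule of
    \<open>chi\<close> counts integer steps.\<close>
  have "\<exists>s::int. \<exists>\<theta>. s \<in> {1, -1 :: int} \<and>
      triangle_normals (p t) (q t) (r t) (dir \<theta>) (dir (\<theta> + s * (pi - 2 * pi / 3)))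
        (dir (\<theta> + s * (pi - 2 * pi / 3) + s * (pi - \<alpha>)))" if t: "t \<in> F" for t
  proof -
    obtain \<sigma> \<theta> where \<sigma>: "\<sigma> = 1 \<or> \<sigma> = -1" and n: "triangle_normals (p t) (q t) (r t) (dir \<theta>)
        (dir (\<theta> + \<sigma> * (pi - 2 * pi / 3))) (dir (\<theta> + \<sigma> * (pi - 2 * pi / 3) + \<sigma> * (pi - \<alpha>)))"
      using triangle_normals_exist[OF nc[OF t]] unfolding tile_angles[OF t] .
    obtain s :: int where s: "\<sigma> = s" "s = 1 \<or> s = -1"
      using \<sigma> that[of 1] that[of "-1"] by auto
    show ?thesis
      using s(2) n[unfolded s(1)] by (intro exI[of _ s] exI[of _ \<theta>] conjI) auto
  qed
  then obtain s :: "(real^2) set \<Rightarrow> int" and \<theta>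
    where s: "\<And>t. t \<in> F \<Longrightarrow> s t \<in> {1, -1 :: int}"
      and tiles: "\<And>t. t \<in> F \<Longrightarrow> triangle_normals (p t) (q t) (r t) (dir (\<theta> t))
        (dir (\<theta> t + s t * (pi - 2 * pi / 3)))
        (dir (\<theta> t + s t * (pi - 2 * pi / 3) + s t * (pi - \<alpha>)))"
    by metis
  obtain s0 :: int where s0: "\<sigma>0 = s0"
    using \<sigma>0 that[of 1] that[of "-1"] by auto
  \<comment> \<open>A signed count of tiles by the character at the normal of their side
    \<open>a\<close>, based at a normal of the big triangle. Tiles off its orbit count 0.\<close>
  define n where "n e = (\<Sum>t\<in>F. chi \<theta>0 \<alpha> e (dir (\<theta> t)))" for e
  have n_le: "\<bar>n e\<bar> \<le> int N" for e
  proof -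
    have "\<bar>n e\<bar> \<le> (\<Sum>t\<in>F. \<bar>chi \<theta>0 \<alpha> e (dir (\<theta> t))\<bar>)" unfolding n_def by (rule sum_abs)
    also have "\<dots> \<le> (\<Sum>t\<in>F. 1)" by (intro sum_mono abs_chi_le)
    finally show ?thesis using F(2) by simp
  qed
  have n: "3 * S = n e * (a - b + (if even e then c else - c))" for e
  proof -
    define g where "g d = real_of_int (chi \<theta>0 \<alpha> e d)" for d
    have "3 * S = dist B C * g (dir \<theta>0) + dist C A * g (dir (\<theta>0 + \<sigma>0 * (pi - pi / 3)))
        + dist A B * g (dir (\<theta>0 + \<sigma>0 * (pi - pi / 3) + \<sigma>0 * (pi - pi / 3)))"
      unfolding g_def s0 chi_sum_equilateral[OF assms(7)] sides by simp
    also have "\<dots> = (\<Sum>t\<in>F. dist (q t) (r t) * g (dir (\<theta> t))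
        + dist (r t) (p t) * g (dir (\<theta> t + s t * (pi - 2 * pi / 3)))
        + dist (p t) (q t) * g (dir (\<theta> t + s t * (pi - 2 * pi / 3) + s t * (pi - \<alpha>))))"
      by (rule normal_weight_sum[OF _ ABC tiles]) (auto simp: g_def chi_uminus)
    also have "\<dots> = (\<Sum>t\<in>F. g (dir (\<theta> t)) * (a - b + (if even e then c else - c)))"
      unfolding g_def
      by (intro sum.cong refl) (simp only: pqr(2-4) chi_sum_tile[OF s])
    also have "\<dots> = n e * (a - b + (if even e then c else - c))"
      unfolding sum_distrib_right[symmetric] by (simp add: g_def n_def)
    finally show ?thesis .
  qed

  \<comment> \<open>The angles \<open>pi / 3\<close> and \<open>2 * pi / 3\<close> have the same
    sine, which cancels from the comparison of areas.\<close>
  have area: "S\<^sup>2 = N * (a * b)"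
  proof -
    have "S * S * sin (pi / 3) = 2 * measure lebesgue (convex hull {A, B, C})"
      using area_angle[of A B C] sides ABC_angles by simp
    also have "\<dots> = (\<Sum>t\<in>F. 2 * measure lebesgue t)"
      unfolding area_sum sum_distrib_left ..
    also have "\<dots> = (\<Sum>t\<in>F. a * b * sin (pi / 3))"
    proof (rule sum.cong[OF refl])
      fix t assume t: "t \<in> F"
      have "2 * measure lebesgue t = 2 * measure lebesgue (convex hull {p t, q t, r t})"
        using pqr(1)[OF t] by simp
      also have "\<dots> = a * b * sin (pi / 3)"
        unfolding area_angle tile_angles[OF t] pqr(2,3)[OF t] sin_two_pi_thirds ..
      finally show "2 * measure lebesgue t = a * b * sin (pi / 3)" .
    qed
    also have "\<dots> = N * (a * b) * sin (pi / 3)" using F(2) by simp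
    finally show ?thesis by (simp add: power2_eq_square sin_60)
  qed
  obtain x y z :: nat where xyz: "S = x * a + y * b + z * c"
    using side_decomposition[of "dir \<theta>0" a b c] ABC pqr(2-4) unfolding triangle_normals_def S_def by blast
  have n0: "n 0 * (c + a - b) = 3 * S" using n[of 0] by (simp add: algebra_simps)
  \<comment> \<open>For odd \<open>e\<close> the factor is \<open>a - b - c\<close>, the negative of
    \<open>c - a + b\<close>, so the second integer is \<open>- n 1\<close>.\<close>
  have n1: "real_of_int (- n 1) * (c - a + b) = 3 * S" using n[of 1] by (simp add: algebra_simps)
  have "\<bar>- n 1\<bar> \<le> int N" using n_le[of 1] by simp
  with prime_tile_count_impossible[OF pos \<open>a \<noteq> b\<close> cos_law area n0 n_le n1 _ xyz \<open>prime N\<close>]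
  show False .
qed

end
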